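(* Let $n\ge1$ and $R\in\mathcal C_n^*$. Then the quotient graph $Q_R$ is regular if and only if the reduced arc diagram of $R$ is simple, i.e., every maximal element of $F_R$ is a simple fence. In that case $Q_R$ is $(n-1)$-regular.
   Context: $S_n$ is the set of permutations of $[n]$ with the weak order (inclusion of inversion sets); a lattice congruence is an equivalence relation compatible with joins and meets. Fences. $]a,b[=\{a+1,\dots,b-1\}$. For $1\le a<b\le n$ and $L\subseteq\,]a,b[$, the fence $f(a,b,L)$ is the set of cover edges joining permutations that differ by swapping adjacent entries $a,b$, with the values of $L$ left of $a,b$ and those of $]a,b[\setminus L$ to the right. Forcing order: $f(a,b,L)\prec f(c,d,M)$ iff $a\le c<d\le b$, $(a,b)\ne(c,d)$, $M=L\cap\,]c,d[$. Reading's theorem. Lattice congruences $R$ correspond bijectively to downsets $F_R$ of the forcing order (a cover edge joins equivalent permutations iff it lies in a fence of $F_R$). $R$ is essential if $F_R$ contains no $f(a,a+1,\emptyset)$; $\mathcal C_n^*$ is the set of essential congruences. The reduced arc diagram of $R$ is the set of maximal elements of $F_R$. A fence $f(a,b,L)$ is simple if $b-a\ge2$ and $L=\emptyset$ or $L=\,]a,b[$. $Q_R$ is the undirected cover graph of $S_n/R$. *)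

theory Defs
  imports Main
begin

definition perms :: "nat \<Rightarrow> nat list set" where
  "perms n = {w. distinct w \<and> set w = {1..n}}"

definition inversions :: "nat list \<Rightarrow> (nat \<times> nat) set" where
  "inversions w = {(a,b). a < b \<and> (\<exists>i j. i < j \<and> j < length w \<and> w ! i = b \<and> w ! j = a)}"

definition weak_le :: "nat list \<Rightarrow> nat list \<Rightarrow> bool" where
  "weak_le u v \<longleftrightarrow> inversions u \<subseteq> inversions v"

definition is_join :: "nat \<Rightarrow> nat list \<Rightarrow> nat list \<Rightarrow> nat list \<Rightarrow> bool" where
  "is_join n x y z \<longleftrightarrow> z \<in> perms n \<and> weak_le x z \<and> weak_le y z \<and>
     (\<forall>u\<in>perms n. weak_le x u \<and> weak_le y u \<longrightarrow> weak_le z u)"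

definition is_meet :: "nat \<Rightarrow> nat list \<Rightarrow> nat list \<Rightarrow> nat list \<Rightarrow> bool" where
  "is_meet n x y z \<longleftrightarrow> z \<in> perms n \<and> weak_le z x \<and> weak_le z y \<and>
     (\<forall>u\<in>perms n. weak_le u x \<and> weak_le u y \<longrightarrow> weak_le u z)"

definition lattice_congruence :: "nat \<Rightarrow> (nat list \<times> nat list) set \<Rightarrow> bool" where
  "lattice_congruence n R \<longleftrightarrow> equiv (perms n) R \<and>
     (\<forall>x y z u v. (x, y) \<in> R \<and> z \<in> perms n \<longrightarrow>
        (is_join n x z u \<and> is_join n y z v \<longrightarrow> (u, v) \<in> R) \<and>
        (is_meet n x z u \<and> is_meet n y z v \<longrightarrow> (u, v) \<in> R))"

text \<open>Fences, encoded by triples (a,b,L). The edge (w,w') (w below w') belongs to the fence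
  f(a,b,L) iff w = xs@[a,b]@ys, w' = xs@[b,a]@ys and the values of ]a,b[ to the left are exactly L.\<close>
type_synonym fence = "nat \<times> nat \<times> nat set"

definition is_fence :: "nat \<Rightarrow> fence \<Rightarrow> bool" where
  "is_fence n f \<longleftrightarrow> (case f of (a, b, L) \<Rightarrow> 1 \<le> a \<and> a < b \<and> b \<le> n \<and> L \<subseteq> {a<..<b})"

definition fence_edge :: "nat \<Rightarrow> fence \<Rightarrow> nat list \<Rightarrow> nat list \<Rightarrow> bool" where
  "fence_edge n f w w' \<longleftrightarrow> (case f of (a, b, L) \<Rightarrow>
     w \<in> perms n \<and> (\<exists>xs ys. w = xs @ [a, b] @ ys \<and> w' = xs @ [b, a] @ ys \<and>
        set xs \<inter> {a<..<b} = L))"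

definition forces_lt :: "fence \<Rightarrow> fence \<Rightarrow> bool" where
  "forces_lt f g \<longleftrightarrow> (case f of (a, b, L) \<Rightarrow> case g of (c, d, M) \<Rightarrow>
     a \<le> c \<and> c < d \<and> d \<le> b \<and> (a, b) \<noteq> (c, d) \<and> M = L \<inter> {c<..<d})"

definition contracted_fences :: "nat \<Rightarrow> (nat list \<times> nat list) set \<Rightarrow> fence set" where
  "contracted_fences n R = {f. is_fence n f \<and> (\<forall>w w'. fence_edge n f w w' \<longrightarrow> (w, w') \<in> R)}"

definition essential :: "nat \<Rightarrow> (nat list \<times> nat list) set \<Rightarrow> bool" where
  "essential n R \<longleftrightarrow> (\<forall>a. (a, Suc a, {}) \<notin> contracted_fences n R)"

definition reduced_arc_diagram :: "nat \<Rightarrow> (nat list \<times> nat list) set \<Rightarrow> fence set" where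
  "reduced_arc_diagram n R = {f \<in> contracted_fences n R.
      \<not> (\<exists>g \<in> contracted_fences n R. forces_lt f g)}"

definition simple_fence :: "fence \<Rightarrow> bool" where
  "simple_fence f \<longleftrightarrow> (case f of (a, b, L) \<Rightarrow> b - a \<ge> 2 \<and> (L = {} \<or> L = {a<..<b}))"

definition quot_le :: "nat list set \<Rightarrow> nat list set \<Rightarrow> bool" where
  "quot_le X Y \<longleftrightarrow> (\<exists>x\<in>X. \<exists>y\<in>Y. weak_le x y)"

definition quot_cover :: "nat \<Rightarrow> (nat list \<times> nat list) set \<Rightarrow> nat list set \<Rightarrow> nat list set \<Rightarrow> bool" where
  "quot_cover n R X Y \<longleftrightarrow> X \<in> perms n // R \<and> Y \<in> perms n // R \<and> X \<noteq> Y \<and> quot_le X Y \<and>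
     \<not> (\<exists>Z \<in> perms n // R. Z \<noteq> X \<and> Z \<noteq> Y \<and> quot_le X Z \<and> quot_le Z Y)"

definition Q_neighbors :: "nat \<Rightarrow> (nat list \<times> nat list) set \<Rightarrow> nat list set \<Rightarrow> nat list set set" where
  "Q_neighbors n R X = {Y. quot_cover n R X Y \<or> quot_cover n R Y X}"

definition Q_regular_of_degree :: "nat \<Rightarrow> (nat list \<times> nat list) set \<Rightarrow> nat \<Rightarrow> bool" where
  "Q_regular_of_degree n R k \<longleftrightarrow> (\<forall>X \<in> perms n // R. card (Q_neighbors n R X) = k)"

definition Q_regular :: "nat \<Rightarrow> (nat list \<times> nat list) set \<Rightarrow> bool" where
  "Q_regular n R \<longleftrightarrow> (\<exists>k. Q_regular_of_degree n R k)"

end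

theory Submission
  imports Defs
begin

text \<open>Each class \<open>X\<close> of a congruence is an interval \<open>[u, v]\<close> of the weak order, its upper neighbours in
  the quotient correspond to the ascents of \<open>v\<close> and its lower neighbours to the descents of \<open>u\<close>. So the
  degree of \<open>X\<close> is \<open>n - 1 + des u - des v\<close>, and since the class of the identity has degree \<open>n - 1\<close>,
  regularity means \<open>des u = des v\<close> for all classes.

  If all maximal contracted fences are simple, this follows by induction on \<open>n\<close>: removing the value \<open>n\<close>
  from \<open>u\<close> and \<open>v\<close> gives the minimum and the maximum of a class for \<open>n - 1\<close>. Call \<open>p\<close> a cut if the edge
  along which \<open>n\<close> crosses \<open>p\<close> is not contracted. The sequence of cuts is constant on a class, and \<open>n\<close> sits
  between the same two consecutive cuts in \<open>u\<close> (directly before the right one) and in \<open>v\<close> (directly after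
  the left one). Simplicity makes these two cuts adjacent in \<open>u\<close> if they form a descent and adjacent in
  \<open>v\<close> if they form an ascent, and then inserting \<open>n\<close> changes both numbers of descents equally.

  If a maximal contracted fence \<open>f(a,b,L)\<close> is not simple, then the word \<open>1 .. a-1, L, a, b, ]a,b[ - L, b+1 .. n\<close>
  with increasing blocks is the minimum of its class and has two descents, while the maximum has
  only one.\<close>

section \<open>The weak order\<close>

text \<open>The classes are not described explicitly: their extreme elements enter through the local
  condition that no contracted edge leads down, or up. Such words can be compared one value at a
  time, because deleting the largest value preserves the condition: a contracted pair that becomes
  adjacent would already have contracted an edge of the deleted value. Essentiality says that
  \<open>n - 1\<close> is always a cut for \<open>n\<close>. Hence \<open>n\<close> cannot travel
  along contracted edges from the last place to the first, where it would create a descent.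
  Simplicity enters through a shortest contracted interval inside a given one. Its fence is maximal
  in \<open>F_R\<close>, so the values strictly inside it are all on the left or all on the right. A
  value on the left and a value on the right, both strictly inside, are the contradiction aimed
  at.\<close>

definition bef :: "'a list \<Rightarrow> 'a \<Rightarrow> 'a \<Rightarrow> bool" where
  "bef w a b \<longleftrightarrow> (\<exists>i j. i < j \<and> j < length w \<and> w ! i = a \<and> w ! j = b)"

lemma bef_Nil [simp]: "\<not> bef [] a b"
  by (simp add: bef_def)

lemma bef_Cons [simp]: "bef (x # xs) a b \<longleftrightarrow> a = x \<and> b \<in> set xs \<or> bef xs a b"
proof
  assume "bef (x # xs) a b"
  then obtain i j where *: "i < j" "j < length (x # xs)" "(x # xs) ! i = a" "(x # xs) ! j = b"
    unfolding bef_def by blast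
  then obtain j' where "j = Suc j'" by (cases j) auto
  with * show "a = x \<and> b \<in> set xs \<or> bef xs a b"
    by (cases i) (auto simp: bef_def)
next
  assume "a = x \<and> b \<in> set xs \<or> bef xs a b"
  then show "bef (x # xs) a b"
  proof
    assume *: "a = x \<and> b \<in> set xs"
    then obtain j where "j < length xs" "xs ! j = b" by (auto simp: in_set_conv_nth)
    with * show ?thesis unfolding bef_def by (intro exI[of _ 0] exI[of _ "Suc j"]) auto
  next
    assume "bef xs a b"
    then obtain i j where "i < j" "j < length xs" "xs ! i = a" "xs ! j = b"
      unfolding bef_def by blast
    then show ?thesis unfolding bef_def by (intro exI[of _ "Suc i"] exI[of _ "Suc j"]) auto
  qed
qed

lemma bef_append [simp]:
  "bef (xs @ ys) a b \<longleftrightarrow> bef xs a b \<or> bef ys a b \<or> a \<in> set xs \<and> b \<in> set ys"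
  by (induction xs) auto

lemma bef_in_set: "bef w a b \<Longrightarrow> a \<in> set w \<and> b \<in> set w"
  by (induction w) auto

lemma bef_trans: "distinct w \<Longrightarrow> bef w a b \<Longrightarrow> bef w b c \<Longrightarrow> bef w a c"
  by (induction w) (auto dest: bef_in_set)

lemma bef_asym: "distinct w \<Longrightarrow> bef w a b \<Longrightarrow> \<not> bef w b a"
  by (induction w) (auto dest: bef_in_set)

lemma bef_total: "a \<in> set w \<Longrightarrow> b \<in> set w \<Longrightarrow> a \<noteq> b \<Longrightarrow> bef w a b \<or> bef w b a"
  by (induction w) auto

lemma inversions_iff: "(a, b) \<in> inversions w \<longleftrightarrow> a < b \<and> bef w b a"
  by (auto simp: inversions_def bef_def)

lemma finite_inversions: "finite (inversions w)"
  by (rule finite_subset[of _ "set w \<times> set w"]) (auto simp: inversions_iff dest: bef_in_set)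

lemma inversions_swap:
  "a < b \<Longrightarrow> inversions (xs @ b # a # ys) = insert (a, b) (inversions (xs @ a # b # ys))"
  by (auto simp: inversions_iff)

lemma finite_perms: "finite (perms n)"
proof (rule finite_subset)
  show "perms n \<subseteq> {w. set w \<subseteq> {1..n} \<and> length w = n}"
    by (auto simp: perms_def dest: distinct_card)
qed (rule finite_lists_length_eq, simp)

lemma perms_swap: "xs @ b # a # ys \<in> perms n \<longleftrightarrow> xs @ a # b # ys \<in> perms n"
proof -
  have "set (xs @ b # a # ys) = set (xs @ a # b # ys)" by auto
  then show ?thesis unfolding perms_def by auto
qed

lemma inversions_trans:
  "w \<in> perms n \<Longrightarrow> (a, b) \<in> inversions w \<Longrightarrow> (b, c) \<in> inversions w \<Longrightarrow> (a, c) \<in> inversions w"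
  by (auto simp: inversions_iff perms_def intro: bef_trans)

lemma inversions_cotrans:
  assumes "w \<in> perms n" "(a, c) \<in> inversions w" "a < b" "b < c"
  shows "(a, b) \<in> inversions w \<or> (b, c) \<in> inversions w"
proof -
  have "a \<in> set w" "c \<in> set w" and d: "distinct w"
    using assms by (auto simp: inversions_iff perms_def dest: bef_in_set)
  then have "b \<in> set w" using assms by (auto simp: perms_def)
  with \<open>c \<in> set w\<close> have "bef w b c \<or> bef w c b" using assms bef_total[of b w c] by auto
  then show ?thesis using assms d by (auto simp: inversions_iff intro: bef_trans)
qed

text \<open>If the first letters \<open>a\<close> and \<open>b\<close> differed, the pair they form
  would be inverted in exactly one of the two words.\<close>

lemma inversions_inj_aux:
  "distinct x \<Longrightarrow> distinct y \<Longrightarrow> set x = set y \<Longrightarrow> inversions x = inversions y \<Longrightarrow> x = (y :: nat list)"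
proof (induction x arbitrary: y)
  case Nil
  then show ?case by simp
next
  case (Cons a xs)
  then obtain b ys where y: "y = b # ys" by (cases y) auto
  have inv: "p < q \<Longrightarrow> bef (a # xs) q p \<longleftrightarrow> bef (b # ys) q p" for p q
    using Cons.prems(4) y by (metis inversions_iff)
  have "a = b"
  proof (rule ccontr)
    assume "a \<noteq> b"
    then have *: "b \<in> set xs" "a \<in> set ys" using Cons.prems y by auto
    show False
    proof (cases "a < b")
      case True
      then show False using inv[of a b] * Cons.prems(1,2) y \<open>a \<noteq> b\<close> by (auto dest: bef_in_set)
    next
      case False
      then show False using inv[of b a] * Cons.prems(1,2) y \<open>a \<noteq> b\<close> by (auto dest: bef_in_set)
    qed
  qed
  moreover have "set xs = set ys" using Cons.prems y \<open>a = b\<close> by auto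
  moreover have "inversions xs = inversions ys"
  proof -
    have "p < q \<Longrightarrow> bef xs q p \<longleftrightarrow> bef ys q p" for p q
      using inv[of p q] Cons.prems(1,2) y \<open>a = b\<close> \<open>set xs = set ys\<close> by (auto dest: bef_in_set)
    then show ?thesis by (auto simp: inversions_iff)
  qed
  ultimately show ?case using Cons y by auto
qed

lemma weak_le_antisym: "x \<in> perms n \<Longrightarrow> y \<in> perms n \<Longrightarrow> weak_le x y \<Longrightarrow> weak_le y x \<Longrightarrow> x = y"
  unfolding weak_le_def perms_def by (intro inversions_inj_aux) auto

text \<open>The cover relation of the weak order on permutations, see \<open>up_inversions\<close>
  and \<open>up_between\<close>.\<close>

definition up :: "nat list \<Rightarrow> nat list \<Rightarrow> bool" where
  "up w z \<longleftrightarrow> (\<exists>xs a b ys. w = xs @ a # b # ys \<and> z = xs @ b # a # ys \<and> a < b)"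

lemma upI: "a < b \<Longrightarrow> up (xs @ a # b # ys) (xs @ b # a # ys)"
  by (auto simp: up_def)

lemma up_perms: "up w z \<Longrightarrow> w \<in> perms n \<longleftrightarrow> z \<in> perms n"
  using perms_swap unfolding up_def by blast

lemma up_inversions:
  assumes "up w z" "w \<in> perms n"
  obtains p where "inversions z = insert p (inversions w)" "p \<notin> inversions w"
proof -
  from assms(1) obtain xs a b ys where *: "w = xs @ a # b # ys" "z = xs @ b # a # ys" "a < b"
    by (auto simp: up_def)
  have "(a, b) \<notin> inversions w"
    using assms(2) * bef_asym[of w a b] by (auto simp: inversions_iff perms_def)
  with * inversions_swap[of a b xs ys] that show thesis by auto
qed

lemma up_weak_le: "up w z \<Longrightarrow> weak_le w z"
  by (auto simp: up_def weak_le_def inversions_swap)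

text \<open>Suppose no ascent of \<open>x\<close> can be swapped below \<open>y\<close>. Then every
  adjacent pair of \<open>x\<close> stands in the same order in \<open>y\<close>: an ascent because
  its swap would add an inversion missing in \<open>y\<close>, a descent because \<open>x\<close>
  lies below \<open>y\<close>. By transitivity the two words agree.\<close>

lemma exists_up_below:
  assumes x: "x \<in> perms n" and y: "y \<in> perms n" and le: "weak_le x y" and ne: "x \<noteq> y"
  shows "\<exists>z. up x z \<and> weak_le z y"
proof (rule ccontr)
  assume no: "\<nexists>z. up x z \<and> weak_le z y"
  have dx: "distinct x" and dy: "distinct y" and s: "set x = set y"
    using x y by (auto simp: perms_def)
  have adj: "bef y a b" if eq: "x = xs @ a # b # ys" for xs a b ys
  proof -
    have ab: "a \<noteq> b" "a \<in> set y" "b \<in> set y" using dx s eq by auto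
    show ?thesis
    proof (cases "a < b")
      case True
      then have "\<not> weak_le (xs @ b # a # ys) y" using no eq upI by blast
      then have "(a, b) \<notin> inversions y"
        using le True eq by (auto simp: weak_le_def inversions_swap)
      then show ?thesis using True bef_total[of a y b] ab by (auto simp: inversions_iff)
    next
      case False
      then have "(b, a) \<in> inversions x" using eq ab by (auto simp: inversions_iff)
      then have "(b, a) \<in> inversions y" using le by (auto simp: weak_le_def)
      then show ?thesis by (simp add: inversions_iff)
    qed
  qed
  have "successively (bef y) x"
    using adj
  proof (induction x)
    case (Cons a x)
    have "successively (bef y) x"
      using Cons.prems by (intro Cons.IH) (metis append_Cons)
    then show ?case using Cons.prems[of "[]"] by (cases x) auto
  qed simp
  moreover have "transp (bef y)" using bef_trans[OF dy] by (auto simp: transp_def)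
  ultimately have srt: "sorted_wrt (bef y) x" by (simp add: successively_conv_sorted_wrt)
  have "bef y a b" if "bef x a b" for a b
    using that srt by (induction x) auto
  then have "bef x b a" if "bef y b a" for a b
    using that bef_total[of a x b] bef_asym[OF dy] bef_in_set[OF that] s by metis
  then have "inversions y \<subseteq> inversions x" by (auto simp: inversions_iff)
  then show False using weak_le_antisym[OF x y le] ne by (auto simp: weak_le_def)
qed

lemma is_join_iff: "is_join n x y z \<longleftrightarrow> z \<in> perms n \<and> inversions x \<subseteq> inversions z \<and>
   inversions y \<subseteq> inversions z \<and>
   (\<forall>u\<in>perms n. inversions x \<subseteq> inversions u \<and> inversions y \<subseteq> inversions u \<longrightarrow> inversions z \<subseteq> inversions u)"
  by (simp add: is_join_def weak_le_def)

lemma is_meet_iff: "is_meet n x y z \<longleftrightarrow> z \<in> perms n \<and> inversions z \<subseteq> inversions x \<and>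
   inversions z \<subseteq> inversions y \<and>
   (\<forall>u\<in>perms n. inversions u \<subseteq> inversions x \<and> inversions u \<subseteq> inversions y \<longrightarrow> inversions u \<subseteq> inversions z)"
  by (simp add: is_meet_def weak_le_def)

section \<open>Joins and meets in the weak order\<close>

lemma inversions_hexagon:
  assumes "a < b" "b < c"
    and "I = inversions (xs @ a # b # c # ys)"
  shows "inversions (xs @ b # a # c # ys) = insert (a, b) I"
    "inversions (xs @ a # c # b # ys) = insert (b, c) I"
    "inversions (xs @ b # c # a # ys) = insert (a, c) (insert (a, b) I)"
    "inversions (xs @ c # a # b # ys) = insert (a, c) (insert (b, c) I)"
    "inversions (xs @ c # b # a # ys) = insert (b, c) (insert (a, c) (insert (a, b) I))"
  using assms by (auto simp: inversions_iff)

text \<open>Inversion sets are transitive, so an upper bound with \<open>(a, b)\<close> and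
  \<open>(b, c)\<close> also has \<open>(a, c)\<close>. Dually, cotransitivity identifies the bottom
  of the hexagon as a meet.\<close>

lemma is_join_hexagon:
  assumes "xs @ a # b # c # ys \<in> perms n" "a < b" "b < c"
  shows "is_join n (xs @ b # a # c # ys) (xs @ a # c # b # ys) (xs @ c # b # a # ys)"
proof -
  have "xs @ c # b # a # ys \<in> perms n"
    using assms(1) perms_swap[of xs] perms_swap[of "xs @ [b]" c a ys] perms_swap[of xs c b] by simp
  moreover have "inversions (xs @ c # b # a # ys) \<subseteq> inversions u"
    if "u \<in> perms n" "inversions (xs @ b # a # c # ys) \<subseteq> inversions u"
      "inversions (xs @ a # c # b # ys) \<subseteq> inversions u" for u
    using that inversions_trans[of u n a b c] by (simp add: inversions_hexagon[OF assms(2,3) refl])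
  ultimately show ?thesis
    unfolding is_join_iff by (auto simp: inversions_hexagon[OF assms(2,3) refl])
qed

lemma is_meet_hexagon:
  assumes "xs @ a # b # c # ys \<in> perms n" "a < b" "b < c"
  shows "is_meet n (xs @ b # c # a # ys) (xs @ c # a # b # ys) (xs @ a # b # c # ys)"
proof -
  let ?I = "inversions (xs @ a # b # c # ys)"
  have d: "distinct (xs @ a # b # c # ys)" using assms by (auto simp: perms_def)
  have *: "(a, b) \<notin> ?I" "(b, c) \<notin> ?I" "(a, c) \<notin> ?I"
    using d bef_asym[OF d, of a b] bef_asym[OF d, of b c] bef_asym[OF d, of a c]
    by (auto simp: inversions_iff)
  have "inversions u \<subseteq> ?I" if u: "u \<in> perms n" "inversions u \<subseteq> insert (a, c) (insert (a, b) ?I)"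
    "inversions u \<subseteq> insert (a, c) (insert (b, c) ?I)" for u
  proof -
    have "(a, b) \<notin> inversions u" using u(3) * assms(2,3) by auto
    moreover have "(b, c) \<notin> inversions u" using u(2) * assms(2,3) by auto
    ultimately have "(a, c) \<notin> inversions u" using inversions_cotrans u(1) assms(2,3) by blast
    with \<open>(a, b) \<notin> inversions u\<close> u(2) show ?thesis by auto
  qed
  then show ?thesis
    using assms(1) unfolding is_meet_iff by (auto simp: inversions_hexagon[OF assms(2,3) refl])
qed

text \<open>Two upward swaps at different places span a hexagon if they share a letter
  (\<open>zs = []\<close>, that is \<open>b = c\<close>) and a square otherwise.\<close>

lemma exists_join_of_ups_aux:
  assumes x: "xs @ a # b # ys \<in> perms n" "a < b" "c < d"
    and eq: "xs @ a # b # ys = xs' @ c # d # ys'" and len: "length xs < length xs'"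
  shows "\<exists>t. is_join n (xs @ b # a # ys) (xs' @ d # c # ys') t"
proof -
  from eq len obtain zs where zs: "xs' = xs @ a # zs" "b # ys = zs @ c # d # ys'"
    by (auto simp: append_eq_append_conv2 Cons_eq_append_conv)
  show ?thesis
  proof (cases zs)
    case Nil
    then show ?thesis using zs x is_join_hexagon[of xs a b d ys' n] by auto
  next
    case (Cons e zs')
    then have e: "zs = b # zs'" "ys = zs' @ c # d # ys'" using zs by auto
    let ?t = "xs @ b # a # zs' @ d # c # ys'"
    have "?t \<in> perms n"
      using x e perms_swap[of xs] perms_swap[of "xs @ b # a # zs'" d c ys'] by simp
    moreover have "inversions ?t = insert (c, d) (inversions (xs @ b # a # ys))"
      using inversions_swap[of c d "xs @ b # a # zs'" ys'] x e by simp
    moreover have "inversions ?t = insert (a, b) (inversions (xs' @ d # c # ys'))"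
      using inversions_swap[of a b xs "zs' @ d # c # ys'"] x e zs by simp
    moreover have "(a, b) \<in> inversions (xs @ b # a # ys)" "(c, d) \<in> inversions (xs' @ d # c # ys')"
      using x(2,3) by (auto simp: inversions_iff)
    ultimately have "is_join n (xs @ b # a # ys) (xs' @ d # c # ys') ?t"
      unfolding is_join_iff by (metis insert_subset subset_insertI subsetD)
    then show ?thesis by blast
  qed
qed

lemma is_join_commute: "is_join n x y z \<Longrightarrow> is_join n y x z"
  by (auto simp: is_join_def)

lemma exists_join_of_ups:
  assumes "x \<in> perms n" "up x y" "up x z"
  shows "\<exists>t. is_join n y z t"
proof -
  from assms(2,3) obtain xs a b ys xs' c d ys' where
    1: "x = xs @ a # b # ys" "y = xs @ b # a # ys" "a < b" and
    2: "x = xs' @ c # d # ys'" "z = xs' @ d # c # ys'" "c < d"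
    unfolding up_def by blast
  have "length xs < length xs' \<or> length xs' < length xs \<or> length xs = length xs'" by arith
  then show ?thesis
  proof (elim disjE)
    assume "length xs < length xs'"
    then show ?thesis
      using exists_join_of_ups_aux[of xs a b ys n c d xs' ys'] assms(1) 1 2 by metis
  next
    assume "length xs' < length xs"
    then show ?thesis
      using exists_join_of_ups_aux[of xs' c d ys' n a b xs ys] assms(1) 1 2 is_join_commute by metis
  next
    assume "length xs = length xs'"
    then have "y = z" using 1 2 by (metis append_eq_append_conv list.inject)
    then have "is_join n y z y" using assms up_perms by (auto simp: is_join_def weak_le_def)
    then show ?thesis by blast
  qed
qed

lemma card_inversions_up:
  "up w z \<Longrightarrow> w \<in> perms n \<Longrightarrow> card (inversions z) = Suc (card (inversions w))"
  by (erule (1) up_inversions) (simp add: finite_inversions)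

lemma card_inversions_mono: "weak_le x y \<Longrightarrow> card (inversions x) \<le> card (inversions y)"
  unfolding weak_le_def by (intro card_mono finite_inversions)

text \<open>The argument of Bjorner, Edelman and Ziegler: in a finite bounded poset it suffices that two
  covers of a common element have a join. The induction runs downwards over a common lower bound \<open>z\<close>.\<close>

lemma exists_join_above:
  assumes "z \<in> perms n" "x \<in> perms n" "y \<in> perms n" "weak_le z x" "weak_le z y"
  shows "\<exists>t. is_join n x y t"
proof -
  define B where "B = card ({1..n} \<times> {1..n})"
  have bound: "card (inversions w) \<le> B" if "w \<in> perms n" for w
  proof -
    have "inversions w \<subseteq> {1..n} \<times> {1..n}"
    proof clarify
      fix a b assume "(a, b) \<in> inversions w"
      then have "a \<in> set w \<and> b \<in> set w" using bef_in_set by (fastforce simp: inversions_iff)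
      then show "a \<in> {1..n} \<and> b \<in> {1..n}" using that unfolding perms_def by blast
    qed
    then show ?thesis unfolding B_def by (intro card_mono) auto
  qed
  show ?thesis
    using assms
  proof (induction "B - card (inversions z)" arbitrary: z x y rule: less_induct)
    case less
    show ?case
    proof (cases "z = x \<or> z = y")
      case True
      then have "is_join n x y y \<or> is_join n x y x"
        using less.prems unfolding is_join_def weak_le_def by blast
      then show ?thesis by blast
    next
      case False
      then obtain x1 y1 where x1: "up z x1" "weak_le x1 x" and y1: "up z y1" "weak_le y1 y"
        using exists_up_below less.prems by metis
      have p: "x1 \<in> perms n" "y1 \<in> perms n" using x1(1) y1(1) less.prems(1) up_perms by blast+
      have sm: "B - card (inversions x1) < B - card (inversions z)"
         "B - card (inversions y1) < B - card (inversions z)"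
        using bound[of x1] bound[of y1] p card_inversions_up[OF x1(1) less.prems(1)]
          card_inversions_up[OF y1(1) less.prems(1)] by linarith+
      obtain j where j: "is_join n x1 y1 j" using exists_join_of_ups less.prems x1 y1 by blast
      \<comment> \<open>\<open>x1\<close> is a common lower bound of \<open>x\<close> and
        \<open>j\<close>, and \<open>y1\<close> one of \<open>q\<close> and \<open>y\<close>. Both
        have more inversions than \<open>z\<close>, so the induction hypothesis supplies
        \<open>q\<close> and then \<open>t\<close>.\<close>
      then obtain q where q: "is_join n x j q"
        using less.hyps[OF sm(1) p(1), of x j] x1 less.prems unfolding is_join_def by blast
      have "weak_le y1 q" using j q unfolding is_join_def weak_le_def by blast
      then obtain t where t: "is_join n q y t"
        using less.hyps[OF sm(2) p(2), of q y] y1 q less.prems unfolding is_join_def by blast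
      have "is_join n x y t"
        unfolding is_join_def
      proof (intro conjI ballI impI)
        show "t \<in> perms n" "weak_le x t" "weak_le y t"
          using j q t x1 y1 unfolding is_join_def weak_le_def by blast+
        fix u assume u: "u \<in> perms n" "weak_le x u \<and> weak_le y u"
        then have "weak_le x1 u" "weak_le y1 u" using x1 y1 unfolding weak_le_def by blast+
        then have "weak_le j u" using j u unfolding is_join_def by blast
        then have "weak_le q u" using q u unfolding is_join_def by blast
        then show "weak_le t u" using t u unfolding is_join_def by blast
      qed
      then show ?thesis by blast
    qed
  qed
qed

lemma inversions_upt: "inversions [i..<j] = {}"
proof -
  have "bef [i..<j] b a \<Longrightarrow> b < a" for a b by (auto simp: bef_def)
  then show ?thesis by (force simp: inversions_iff)
qed

lemma ident_perms: "[1..<Suc n] \<in> perms n"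
  by (auto simp: perms_def)

lemma exists_join: "x \<in> perms n \<Longrightarrow> y \<in> perms n \<Longrightarrow> \<exists>t. is_join n x y t"
  using exists_join_above[OF ident_perms] by (simp add: weak_le_def inversions_upt del: upt_Suc)

text \<open>A common lower bound with the most inversions is the meet, since its join with any other lower
  bound is again a lower bound.\<close>

lemma exists_meet:
  assumes "x \<in> perms n" "y \<in> perms n"
  shows "\<exists>t. is_meet n x y t"
proof -
  let ?B = "{z \<in> perms n. weak_le z x \<and> weak_le z y}"
  have "[1..<Suc n] \<in> ?B" using ident_perms[of n] by (simp add: weak_le_def inversions_upt del: upt_Suc)
  moreover have "finite (card ` inversions ` ?B)" using finite_perms by simp
  ultimately have "Max (card ` inversions ` ?B) \<in> card ` inversions ` ?B" by (intro Max_in) blast+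
  then obtain z where z: "z \<in> ?B" "card (inversions z) = Max (card ` inversions ` ?B)" by auto
  have mx: "card (inversions t) \<le> card (inversions z)" if "t \<in> ?B" for t
    unfolding z(2) using that finite_perms by (intro Max_ge) auto
  have "weak_le u z" if u: "u \<in> ?B" for u
  proof -
    obtain t where t: "is_join n u z t" using exists_join u z by blast
    then have "t \<in> ?B" using u z assms unfolding is_join_def by blast
    moreover have zt: "weak_le z t" "weak_le u t" using t unfolding is_join_def by blast+
    ultimately have "inversions z = inversions t"
      using mx[of t] card_seteq[OF finite_inversions[of t], of "inversions z"] unfolding weak_le_def by blast
    then show ?thesis using zt unfolding weak_le_def by blast
  qed
  then have "is_meet n x y z" using z unfolding is_meet_def by blast
  then show ?thesis by blast
qed

text \<open>The bounds \<open>x\<close> and \<open>y\<close> are carried along the chain so that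
  convexity can later place all its elements in one class.\<close>

lemma up_rtranclp:
  assumes "x \<in> perms n" "y \<in> perms n" "weak_le x y"
  shows "(\<lambda>w z. up w z \<and> w \<in> perms n \<and> weak_le x w \<and> weak_le z y)\<^sup>*\<^sup>* x y"
  using assms
proof (induction "card (inversions y) - card (inversions x)" arbitrary: x rule: less_induct)
  case less
  show ?case
  proof (cases "x = y")
    case False
    then obtain z where z: "up x z" "weak_le z y" using exists_up_below less.prems by blast
    have "(\<lambda>v w. up v w \<and> v \<in> perms n \<and> weak_le z v \<and> weak_le w y)\<^sup>*\<^sup>* z y"
      using less.hyps[of z] z(2) less.prems up_perms[OF z(1)] card_inversions_up[OF z(1)]
        card_inversions_mono[OF z(2)] by simp
    moreover have "weak_le x z" using z up_weak_le by blast
    ultimately have "(\<lambda>v w. up v w \<and> v \<in> perms n \<and> weak_le x v \<and> weak_le w y)\<^sup>*\<^sup>* z y"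
      by (elim rtranclp_mono[THEN predicate2D, rotated]) (unfold weak_le_def, blast)
    moreover have "weak_le x x" by (simp add: weak_le_def)
    ultimately show ?thesis using z less.prems(1)
      by (intro converse_rtranclp_into_rtranclp[of _ x z]) simp_all
  qed simp
qed

lemma exists_up_above:
  assumes x: "x \<in> perms n" and y: "y \<in> perms n" and le: "weak_le x y" and ne: "x \<noteq> y"
  shows "\<exists>z. up z y \<and> weak_le x z"
  using up_rtranclp[OF x y le] ne by (auto elim: rtranclp.cases)

section \<open>Quotients of finite lattices\<close>

text \<open>Stated abstractly in order to be instantiated twice, by the weak order and by its dual.
  Facts about upper neighbours and greatest elements then also serve for lower neighbours and least
  elements.\<close>

locale finite_lattice_congruence =
  fixes P :: "'a set" and le :: "'a \<Rightarrow> 'a \<Rightarrow> bool" and covers :: "'a \<Rightarrow> 'a \<Rightarrow> bool"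
    and join meet :: "'a \<Rightarrow> 'a \<Rightarrow> 'a" and R :: "('a \<times> 'a) set"
  assumes finite_P: "finite P"
    and le_refl: "le x x"
    and le_trans: "le x y \<Longrightarrow> le y z \<Longrightarrow> le x z"
    and le_antisym: "x \<in> P \<Longrightarrow> y \<in> P \<Longrightarrow> le x y \<Longrightarrow> le y x \<Longrightarrow> x = y"
    and join_in: "x \<in> P \<Longrightarrow> y \<in> P \<Longrightarrow> join x y \<in> P"
    and join_ge1: "x \<in> P \<Longrightarrow> y \<in> P \<Longrightarrow> le x (join x y)"
    and join_ge2: "x \<in> P \<Longrightarrow> y \<in> P \<Longrightarrow> le y (join x y)"
    and join_least: "x \<in> P \<Longrightarrow> y \<in> P \<Longrightarrow> z \<in> P \<Longrightarrow> le x z \<Longrightarrow> le y z \<Longrightarrow> le (join x y) z"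
    and meet_in: "x \<in> P \<Longrightarrow> y \<in> P \<Longrightarrow> meet x y \<in> P"
    and meet_le1: "x \<in> P \<Longrightarrow> y \<in> P \<Longrightarrow> le (meet x y) x"
    and meet_le2: "x \<in> P \<Longrightarrow> y \<in> P \<Longrightarrow> le (meet x y) y"
    and meet_greatest: "x \<in> P \<Longrightarrow> y \<in> P \<Longrightarrow> z \<in> P \<Longrightarrow> le z x \<Longrightarrow> le z y \<Longrightarrow> le z (meet x y)"
    and covers_in: "x \<in> P \<Longrightarrow> covers x y \<Longrightarrow> y \<in> P"
    and covers_le: "covers x y \<Longrightarrow> le x y"
    and covers_neq: "covers x y \<Longrightarrow> x \<noteq> y"
    and covers_between: "x \<in> P \<Longrightarrow> z \<in> P \<Longrightarrow> covers x y \<Longrightarrow> le x z \<Longrightarrow> le z y \<Longrightarrow> z = x \<or> z = y"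
    and covers_exist: "x \<in> P \<Longrightarrow> y \<in> P \<Longrightarrow> le x y \<Longrightarrow> x \<noteq> y \<Longrightarrow> \<exists>z. covers x z \<and> le z y"
    and equiv_R: "equiv P R"
    and join_R: "(x, y) \<in> R \<Longrightarrow> z \<in> P \<Longrightarrow> (join x z, join y z) \<in> R"
    and meet_R: "(x, y) \<in> R \<Longrightarrow> z \<in> P \<Longrightarrow> (meet x z, meet y z) \<in> R"
begin

definition cls_le :: "'a set \<Rightarrow> 'a set \<Rightarrow> bool" where
  "cls_le X Y \<longleftrightarrow> (\<exists>x\<in>X. \<exists>y\<in>Y. le x y)"

definition cls_covers :: "'a set \<Rightarrow> 'a set \<Rightarrow> bool" where
  "cls_covers X Y \<longleftrightarrow> X \<in> P // R \<and> Y \<in> P // R \<and> X \<noteq> Y \<and> cls_le X Y \<and>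
     \<not> (\<exists>Z \<in> P // R. Z \<noteq> X \<and> Z \<noteq> Y \<and> cls_le X Z \<and> cls_le Z Y)"

definition greatest_in :: "'a set \<Rightarrow> 'a \<Rightarrow> bool" where
  "greatest_in X v \<longleftrightarrow> v \<in> X \<and> (\<forall>x\<in>X. le x v)"

lemma R_P: "(x, y) \<in> R \<Longrightarrow> x \<in> P \<and> y \<in> P"
  using equiv_R by (auto simp: equiv_def refl_on_def)

lemma R_sym: "(x, y) \<in> R \<Longrightarrow> (y, x) \<in> R"
  using equiv_R by (auto simp: equiv_def sym_def)

lemma R_trans: "(x, y) \<in> R \<Longrightarrow> (y, z) \<in> R \<Longrightarrow> (x, z) \<in> R"
  using equiv_R by (auto simp: equiv_def trans_def)

lemma R_refl: "x \<in> P \<Longrightarrow> (x, x) \<in> R"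
  using equiv_R by (auto simp: equiv_def refl_on_def)

lemma cls_R: "X \<in> P // R \<Longrightarrow> x \<in> X \<Longrightarrow> y \<in> X \<longleftrightarrow> (x, y) \<in> R"
  using equiv_R by (meson in_quotient_imp_closed quotient_eq_iff in_quotient_imp_in_rel empty_subsetI insert_subset)

lemma cls_P: "X \<in> P // R \<Longrightarrow> x \<in> X \<Longrightarrow> x \<in> P"
  using cls_R R_P by blast

lemma cls_eq: "X \<in> P // R \<Longrightarrow> x \<in> X \<Longrightarrow> R `` {x} = X"
  using cls_R by blast

lemma cls_eqI: "X \<in> P // R \<Longrightarrow> Y \<in> P // R \<Longrightarrow> x \<in> X \<Longrightarrow> y \<in> Y \<Longrightarrow> (x, y) \<in> R \<Longrightarrow> X = Y"
  by (metis cls_R cls_eq)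

lemma join_absorb: "x \<in> P \<Longrightarrow> y \<in> P \<Longrightarrow> le x y \<Longrightarrow> join x y = y"
  by (simp add: join_ge2 join_in join_least le_antisym le_refl)

lemma join_absorb': "x \<in> P \<Longrightarrow> y \<in> P \<Longrightarrow> le x y \<Longrightarrow> join y x = y"
  by (simp add: join_ge1 join_in join_least le_antisym le_refl)

lemma meet_absorb: "x \<in> P \<Longrightarrow> y \<in> P \<Longrightarrow> le x y \<Longrightarrow> meet x y = x"
  by (simp add: meet_le1 meet_in meet_greatest le_antisym le_refl)

lemma meet_absorb': "x \<in> P \<Longrightarrow> y \<in> P \<Longrightarrow> le x y \<Longrightarrow> meet y x = x"
  by (simp add: meet_le2 meet_in meet_greatest le_antisym le_refl)

text \<open>Joining both sides of \<open>(a, v)\<close> in \<open>R\<close> with \<open>v\<close>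
  shows that a class is closed under joins, and it is finite.\<close>

lemma greatest_exists:
  assumes X: "X \<in> P // R"
  shows "\<exists>v. greatest_in X v"
proof -
  have sub: "X \<subseteq> P" using cls_P[OF X] by blast
  then have fin: "finite X" using finite_P finite_subset by blast
  obtain x0 where x0: "x0 \<in> X" using X equiv_R in_quotient_imp_non_empty by fastforce
  have "\<exists>v\<in>X. \<forall>x\<in>A. le x v" if "finite A" "A \<subseteq> X" for A
    using that
  proof (induction A rule: finite_induct)
    case (insert a A)
    then obtain v where v: "v \<in> X" "\<forall>x\<in>A. le x v" by auto
    have a: "a \<in> X" "a \<in> P" "v \<in> P" using insert v sub by auto
    have "(join a v, join v v) \<in> R" using join_R[of a v v] cls_R[OF X] a v by blast
    then have "(v, join a v) \<in> R" using join_absorb[of v v] le_refl a R_sym by simp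
    then have "join a v \<in> X" using v cls_R[OF X] by blast
    then show ?case
      using join_ge1[of a v] join_ge2[of a v] a v(2) le_trans by blast
  qed (use x0 in blast)
  from this[OF fin] show ?thesis by (auto simp: greatest_in_def)
qed

lemma cls_covers_iff:
  assumes X: "X \<in> P // R" and v: "greatest_in X v"
  shows "cls_covers X Y \<longleftrightarrow> (\<exists>z. covers v z \<and> Y = R `` {z})"
proof
  have vX: "v \<in> X" "v \<in> P" using v cls_P[OF X] by (auto simp: greatest_in_def)
  \<comment> \<open>If \<open>x\<close> is equivalent to \<open>v\<close> and below
    \<open>z\<close>, then \<open>z = join x z\<close> is equivalent to \<open>join v z\<close>. So
    every class above \<open>X\<close> has a representative above \<open>v\<close>.\<close>
  have lift: "\<exists>z\<in>Z. le v z" if Z: "Z \<in> P // R" "cls_le X Z" for Z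
  proof -
    obtain x z where xz: "x \<in> X" "z \<in> Z" "le x z" using Z(2) by (auto simp: cls_le_def)
    then have p: "x \<in> P" "z \<in> P" using X Z cls_P by auto
    have "(join x z, join v z) \<in> R" using xz cls_R[OF X] vX p join_R by blast
    then have "(z, join v z) \<in> R" using join_absorb p xz by simp
    then show ?thesis using cls_R[OF Z(1)] xz join_ge1 p vX by blast
  qed
  {
    assume cov: "cls_covers X Y"
    then have Y: "Y \<in> P // R" by (simp add: cls_covers_def)
    then obtain y where y: "y \<in> Y" "le v y" "y \<in> P"
      using lift[of Y] cov cls_P by (auto simp: cls_covers_def)
    have "v \<noteq> y" using cov y vX cls_eqI[OF X Y vX(1) y(1)] R_refl unfolding cls_covers_def by blast
    then obtain z where z: "covers v z" "le z y" using covers_exist vX y by blast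
    have zP: "z \<in> P" using covers_in vX z by blast
    let ?Z = "R `` {z}"
    have Z: "?Z \<in> P // R" "z \<in> ?Z" using zP R_refl by (auto intro: quotientI)
    have "cls_le X ?Z" "cls_le ?Z Y"
      unfolding cls_le_def using covers_le[OF z(1)] vX z(2) y Z(2) by blast+
    moreover have "?Z \<noteq> X"
    proof
      assume "?Z = X"
      then have "le z v" using Z v by (auto simp: greatest_in_def)
      then show False using covers_le covers_neq le_antisym z vX zP by metis
    qed
    ultimately have "?Z = Y" using cov Z by (auto simp: cls_covers_def)
    then show "\<exists>z. covers v z \<and> Y = R `` {z}" using z by blast
  }
  assume "\<exists>z. covers v z \<and> Y = R `` {z}"
  then obtain y where y: "covers v y" "Y = R `` {y}" by blast
  have yP: "y \<in> P" using y covers_in vX by blast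
  have Y: "Y \<in> P // R" "y \<in> Y" using yP R_refl y by (auto intro: quotientI)
  have yX: "y \<notin> X"
  proof
    assume "y \<in> X"
    then have "le y v" using v by (auto simp: greatest_in_def)
    then show False using covers_le covers_neq le_antisym y(1) vX yP by metis
  qed
  have "Z = X \<or> Z = Y" if Z: "Z \<in> P // R" "cls_le X Z" "cls_le Z Y" for Z
  proof -
    obtain z1 where z1: "z1 \<in> Z" "le v z1" "z1 \<in> P" using lift Z cls_P by blast
    obtain z' y' where z': "z' \<in> Z" "y' \<in> Y" "le z' y'" using Z(3) by (auto simp: cls_le_def)
    then have p: "z' \<in> P" "y' \<in> P" using Z Y cls_P by auto
    \<comment> \<open>An intermediate class \<open>Z\<close> has a representative \<open>z1\<close>
      above \<open>v\<close>. Meeting with \<open>y\<close> keeps it inside \<open>Z\<close>,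
      because \<open>Z\<close> also lies below the class of \<open>y\<close>, and forces it to be
      \<open>v\<close> or \<open>y\<close>.\<close>
    have "(meet y' z', meet y z') \<in> R" using meet_R cls_R[OF Y(1)] z' Y p by blast
    then have "(z', meet y z') \<in> R" using meet_absorb' p z' by simp
    moreover have "(meet z' y, meet z1 y) \<in> R" using meet_R cls_R[OF Z(1)] z1 z' yP by blast
    moreover have "meet z' y = meet y z'"
      using p yP by (intro le_antisym) (simp_all add: meet_in meet_le1 meet_le2 meet_greatest)
    ultimately have "(z', meet z1 y) \<in> R" using R_trans by metis
    then have inZ: "meet z1 y \<in> Z" using cls_R Z z' by blast
    have "meet z1 y = v \<or> meet z1 y = y"
      using z1 yP vX y(1) covers_le by (intro covers_between) (auto intro: meet_in meet_le2 meet_greatest)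
    then show ?thesis
      using inZ cls_eqI[OF Z(1) X _ vX(1)] cls_eqI[OF Z(1) Y(1) _ Y(2)] R_refl vX(2) yP by metis
  qed
  moreover have "cls_le X Y" unfolding cls_le_def using vX Y covers_le y by blast
  ultimately show "cls_covers X Y" unfolding cls_covers_def using X Y yX by blast
qed

text \<open>Distinct covers \<open>y\<close>, \<open>z\<close> of \<open>v\<close> have meet
  \<open>v\<close>. If they were equivalent, then \<open>v\<close> would be equivalent to
  \<open>y\<close>, against the choice of \<open>v\<close> as greatest in its class.\<close>

lemma cls_inj_on_covers:
  assumes X: "X \<in> P // R" and v: "greatest_in X v"
  shows "inj_on (\<lambda>z. R `` {z}) {z. covers v z}"
proof (rule inj_onI, rule ccontr)
  fix y z assume yz: "y \<in> {z. covers v z}" "z \<in> {z. covers v z}" "R `` {y} = R `` {z}" "y \<noteq> z"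
  have vX: "v \<in> X" "v \<in> P" using v cls_P[OF X] by (auto simp: greatest_in_def)
  have p: "y \<in> P" "z \<in> P" using yz covers_in vX by auto
  have R: "(z, y) \<in> R" using yz(3) R_refl[OF p(2)] R_refl[OF p(1)] by auto
  then have "(meet z y, meet y y) \<in> R" using meet_R p by blast
  then have "(meet z y, y) \<in> R" using meet_absorb[of y y] le_refl p by simp
  moreover have "meet z y = v"
  proof -
    have "le v (meet z y)" using yz p vX by (auto intro: meet_greatest covers_le)
    then have "meet z y = v \<or> meet z y = y" "meet z y = v \<or> meet z y = z"
      using yz p vX covers_between meet_in meet_le1 meet_le2 by auto
    then show ?thesis using yz by auto
  qed
  ultimately have "y \<in> X" using cls_R[OF X] vX by blast
  then have "le y v" using v by (auto simp: greatest_in_def)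
  moreover have "covers v y" using yz by simp
  ultimately show False using covers_le covers_neq le_antisym vX p by metis
qed

lemma card_upper_neighbours:
  assumes "X \<in> P // R" "greatest_in X v"
  shows "card {Y. cls_covers X Y} = card {z. covers v z}"
proof -
  have "{Y. cls_covers X Y} = (\<lambda>z. R `` {z}) ` {z. covers v z}"
    using cls_covers_iff[OF assms] by auto
  then show ?thesis using cls_inj_on_covers[OF assms] by (simp add: card_image)
qed

lemma finite_upper_neighbours: "finite {Y. cls_covers X Y}"
  by (rule finite_subset[of _ "P // R"]) (auto simp: cls_covers_def quotient_def finite_P)

text \<open>Two classes covering each other would give a cycle through their greatest elements. This
  makes upper and lower neighbours disjoint, so that their numbers add up to the degree.\<close>

lemma not_cls_covers_both: "\<not> (cls_covers X Y \<and> cls_covers Y X)"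
proof
  assume "cls_covers X Y \<and> cls_covers Y X"
  then have X: "X \<in> P // R" "cls_covers X Y" and Y: "Y \<in> P // R" "cls_covers Y X"
    by (auto simp: cls_covers_def)
  obtain v where v: "greatest_in X v" using greatest_exists X by blast
  obtain w where w: "greatest_in Y w" using greatest_exists Y by blast
  obtain y where y: "covers v y" "Y = R `` {y}" using cls_covers_iff[OF X(1) v] X by blast
  obtain x where x: "covers w x" "X = R `` {x}" using cls_covers_iff[OF Y(1) w] Y by blast
  have p: "v \<in> P" "w \<in> P" "v \<in> X" "w \<in> Y" using v w X Y cls_P by (auto simp: greatest_in_def)
  have "y \<in> P" "x \<in> P" using p x y covers_in by auto
  then have xy: "y \<in> Y" "x \<in> X" using x y R_refl by auto
  then have "le v y" "le y w" "le w x" "le x v"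
    using covers_le x y v w by (auto simp: greatest_in_def)
  then have "v = w" using p le_antisym le_trans by metis
  then show False using p X Y R_refl cls_eqI by (metis cls_covers_def)
qed

end

section \<open>Descents of words and covers\<close>

fun des :: "nat list \<Rightarrow> nat" where
  "des (x # y # zs) = (if x > y then 1 else 0) + des (y # zs)"
| "des _ = 0"

lemma des_append: "des (xs @ x # y # ys) = des (xs @ [x]) + (if x > y then 1 else 0) + des (y # ys)"
proof (induction xs)
  case (Cons a xs)
  then show ?case by (cases xs) auto
qed simp

lemma Cons_eq_append_split:
  "x # y # zs = xs @ a # b # ys \<longleftrightarrow>
     xs = [] \<and> x = a \<and> y = b \<and> zs = ys \<or> (\<exists>xs'. xs = x # xs' \<and> y # zs = xs' @ a # b # ys)"
  by (cases xs) auto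

lemma up_Cons:
  "up (x # y # zs) w \<longleftrightarrow> x < y \<and> w = y # x # zs \<or> (\<exists>w'. up (y # zs) w' \<and> w = x # w')"
proof
  assume "up (x # y # zs) w"
  then show "x < y \<and> w = y # x # zs \<or> (\<exists>w'. up (y # zs) w' \<and> w = x # w')"
    unfolding up_def Cons_eq_append_split by fastforce
next
  assume "x < y \<and> w = y # x # zs \<or> (\<exists>w'. up (y # zs) w' \<and> w = x # w')"
  then show "up (x # y # zs) w"
    using upI[of x y "[]" zs] unfolding up_def by (metis append_Cons append_Nil)
qed

lemma down_Cons:
  "up w (x # y # zs) \<longleftrightarrow> x > y \<and> w = y # x # zs \<or> (\<exists>w'. up w' (y # zs) \<and> w = x # w')"
proof
  assume "up w (x # y # zs)"
  then show "x > y \<and> w = y # x # zs \<or> (\<exists>w'. up w' (y # zs) \<and> w = x # w')"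
    unfolding up_def Cons_eq_append_split by fastforce
next
  assume "x > y \<and> w = y # x # zs \<or> (\<exists>w'. up w' (y # zs) \<and> w = x # w')"
  then show "up w (x # y # zs)"
    using upI[of y x "[]" zs] unfolding up_def by (metis append_Cons append_Nil)
qed

lemma up_short [simp]: "\<not> up [] w" "\<not> up w []" "\<not> up [x] w" "\<not> up w [x]"
  by (auto simp: up_def Cons_eq_append_conv append_eq_Cons_conv)

text \<open>Upper covers correspond to ascents and lower covers to descents; distinctness leaves no
  third kind of adjacent pair. Truncated subtraction covers the empty word.\<close>

lemma card_up_down:
  "distinct w \<Longrightarrow> finite {z. up w z} \<and> card {z. up w z} + des w = length w - 1 \<and>
     finite {z. up z w} \<and> card {z. up z w} = des w"
proof (induction w rule: des.induct)
  case (1 x y zs)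
  let ?U = "{w'. up (y # zs) w'}" and ?D = "{w'. up w' (y # zs)}"
  have U: "{w. up (x # y # zs) w} = (if x < y then {y # x # zs} else {}) \<union> (#) x ` ?U"
    and D: "{w. up w (x # y # zs)} = (if x > y then {y # x # zs} else {}) \<union> (#) x ` ?D"
    by (auto simp: up_Cons down_Cons)
  have n: "y # x # zs \<notin> (#) x ` ?U" "y # x # zs \<notin> (#) x ` ?D" and xy: "x < y \<or> y < x"
    using 1 by auto
  have IH: "finite ?U" "card ?U + des (y # zs) = length zs" "finite ?D" "card ?D = des (y # zs)"
    using 1 by auto
  have "inj ((#) x)" by simp
  then have c: "card ((#) x ` ?U) = card ?U" "card ((#) x ` ?D) = card ?D"
    by (simp_all add: card_image inj_on_def)
  show ?case using xy IH n unfolding U D by (auto simp: c)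
next
  case "2_1"
  have "Collect (up []) = {}" "{z. up z []} = {}" by auto
  then show ?case by simp
next
  case ("2_2" v)
  have "Collect (up [v]) = {}" "{z. up z [v]} = {}" by auto
  then show ?case by simp
qed

section \<open>Contracted fences\<close>

lemma cong_equiv: "lattice_congruence n R \<Longrightarrow> equiv (perms n) R"
  by (simp add: lattice_congruence_def)

lemma cong_join:
  "lattice_congruence n R \<Longrightarrow> (x, y) \<in> R \<Longrightarrow> z \<in> perms n \<Longrightarrow> is_join n x z u \<Longrightarrow> is_join n y z v \<Longrightarrow> (u, v) \<in> R"
  unfolding lattice_congruence_def by blast

lemma cong_meet:
  "lattice_congruence n R \<Longrightarrow> (x, y) \<in> R \<Longrightarrow> z \<in> perms n \<Longrightarrow> is_meet n x z u \<Longrightarrow> is_meet n y z v \<Longrightarrow> (u, v) \<in> R"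
  unfolding lattice_congruence_def by blast

lemma cong_sym: "lattice_congruence n R \<Longrightarrow> (x, y) \<in> R \<Longrightarrow> (y, x) \<in> R"
  by (drule cong_equiv) (auto simp: equiv_def sym_def)

lemma cong_trans: "lattice_congruence n R \<Longrightarrow> (x, y) \<in> R \<Longrightarrow> (y, z) \<in> R \<Longrightarrow> (x, z) \<in> R"
  by (drule cong_equiv) (auto simp: equiv_def trans_def)

lemma cong_perms: "lattice_congruence n R \<Longrightarrow> (x, y) \<in> R \<Longrightarrow> x \<in> perms n \<and> y \<in> perms n"
  by (drule cong_equiv) (auto simp: equiv_def refl_on_def)

lemma is_join_absorb: "y \<in> perms n \<Longrightarrow> weak_le x y \<Longrightarrow> is_join n x y y"
  by (simp add: is_join_def weak_le_def)

lemma is_meet_absorb: "x \<in> perms n \<Longrightarrow> weak_le x y \<Longrightarrow> is_meet n x y x"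
  by (simp add: is_meet_def weak_le_def)

lemma is_meet_commute: "is_meet n x y z \<Longrightarrow> is_meet n y x z"
  by (auto simp: is_meet_def)

text \<open>Meeting both sides of \<open>(x, y)\<close> with \<open>z\<close> turns them into
  \<open>x\<close> and \<open>z\<close>.\<close>

lemma cong_convex:
  assumes R: "lattice_congruence n R" "(x, y) \<in> R" and z: "z \<in> perms n" "weak_le x z" "weak_le z y"
  shows "(x, z) \<in> R" "(z, y) \<in> R"
proof -
  have "x \<in> perms n" using cong_perms[OF R] by blast
  then have "is_meet n x z x" "is_meet n y z z"
    using z is_meet_absorb is_meet_commute by blast+
  then show xz: "(x, z) \<in> R" using cong_meet[OF R z(1)] by blast
  then show "(z, y) \<in> R" using R cong_sym cong_trans by blast
qed

text \<open>For a fence, \<open>m = [b, a]\<close> gives its join-irreducible permutation, whose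
  only descent is \<open>b, a\<close>, and \<open>m = [a, b]\<close> gives the unique lower cover of
  it. Together they form the lowest edge of the fence.\<close>

definition fence_word :: "nat \<Rightarrow> nat \<Rightarrow> nat \<Rightarrow> nat set \<Rightarrow> nat list \<Rightarrow> nat list" where
  "fence_word n a b L m = [1..<a] @ sorted_list_of_set L @ m @
     sorted_list_of_set ({a<..<b} - L) @ [Suc b..<Suc n]"

lemma bef_sorted: "sorted xs \<Longrightarrow> distinct xs \<Longrightarrow> bef xs x y \<Longrightarrow> x < (y :: nat)"
  by (induction xs) (auto simp: order.strict_iff_order)

lemma fence_word_perms:
  assumes "is_fence n (a, b, L)"
  shows "fence_word n a b L [a, b] \<in> perms n"
proof -
  have L: "L \<subseteq> {a<..<b}" "1 \<le> a" "a < b" "b \<le> n" "finite L"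
    using assms finite_subset by (auto simp: is_fence_def)
  have "set (fence_word n a b L [a, b]) = {1..n}"
    using L by (auto simp: fence_word_def simp del: upt_Suc)
  moreover have "distinct (fence_word n a b L [a, b])"
    using L by (auto simp: fence_word_def simp del: upt_Suc)
  ultimately show ?thesis by (simp add: perms_def)
qed

lemma fence_word_swap_perms:
  "is_fence n (a, b, L) \<Longrightarrow> fence_word n a b L [b, a] \<in> perms n"
  using fence_word_perms[of n a b L]
    perms_swap[of "[1..<a] @ sorted_list_of_set L" b a "sorted_list_of_set ({a<..<b} - L) @ [Suc b..<Suc n]" n]
  unfolding fence_word_def append_Cons append_Nil append_assoc by blast

lemma bef_blocks:
  assumes "bef (s @ l @ [a, b] @ r @ g) q p" "distinct (s @ l @ [a, b] @ r @ g)"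
    "\<not> bef s q p" "\<not> bef l q p" "\<not> bef r q p" "\<not> bef g q p"
  shows "q \<in> set s \<and> p \<notin> set s \<or> p \<in> set g \<and> q \<notin> set g \<or>
     q \<in> set l \<and> (p = a \<or> p = b \<or> p \<in> set r) \<or> q = a \<and> p = b \<or> (q = a \<or> q = b) \<and> p \<in> set r"
  using assms by auto

text \<open>Each alternative is an inversion forced in every word that has \<open>a, b\<close>
  adjacent in this order, \<open>L\<close> to their left and the rest of \<open>]a, b[\<close> to
  their right. This is why the word lies below the whole fence.\<close>

lemma inversions_fence_word:
  assumes f: "is_fence n (a, b, L)" and pq: "(p, q) \<in> inversions (fence_word n a b L [a, b])"
  shows "p \<noteq> a \<and> q \<in> L \<and> p \<in> {a<..<b} - L \<or> p = a \<and> q \<in> L \<or> q = b \<and> p \<in> {a<..<b} - L"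
proof -
  have L: "L \<subseteq> {a<..<b}" "1 \<le> a" "a < b" "b \<le> n" "finite L"
    using f finite_subset by (auto simp: is_fence_def)
  have pq': "p < q" "bef (fence_word n a b L [a, b]) q p" using pq by (simp_all add: inversions_iff)
  have *: "\<not> bef xs q p" if "sorted xs" "distinct xs" for xs
    using bef_sorted[OF that, of q p] pq'(1) by auto
  have "bef [1..<a] q p = False" "bef (sorted_list_of_set L) q p = False"
     "bef (sorted_list_of_set ({a<..<b} - L)) q p = False" "bef [Suc b..<Suc n] q p = False"
    using * by (simp_all del: upt_Suc)
  moreover have d: "distinct ([1..<a] @ sorted_list_of_set L @ [a, b] @
      sorted_list_of_set ({a<..<b} - L) @ [Suc b..<Suc n])"
    using fence_word_perms[OF f] unfolding fence_word_def perms_def by blast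
  ultimately have "q \<in> {1..<a} \<and> p \<notin> {1..<a} \<or> p \<in> {Suc b..<Suc n} \<and> q \<notin> {Suc b..<Suc n} \<or>
      q \<in> L \<and> (p = a \<or> p = b \<or> p \<in> {a<..<b} - L) \<or> q = a \<and> p = b \<or>
      (q = a \<or> q = b) \<and> p \<in> {a<..<b} - L"
    using bef_blocks[OF pq'(2)[unfolded fence_word_def] d] L by (simp del: upt_Suc)
  moreover have "p \<in> {1..n}" "q \<in> {1..n}"
    using bef_in_set[OF pq'(2)] fence_word_perms[OF f] unfolding perms_def by blast+
  ultimately show ?thesis
    using pq'(1) L by (elim disjE) auto
qed

lemma inversions_fence_word_swap:
  "a < b \<Longrightarrow> inversions (fence_word n a b L [b, a]) = insert (a, b) (inversions (fence_word n a b L [a, b]))"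
  unfolding fence_word_def
  using inversions_swap[of a b "[1..<a] @ sorted_list_of_set L" "sorted_list_of_set ({a<..<b} - L) @ [Suc b..<Suc n]"]
  by simp

lemma inversions_fence_word_below:
  assumes w: "xs @ a # b # ys \<in> perms n" and ab: "a < b" and L: "L = set xs \<inter> {a<..<b}"
  shows "inversions (fence_word n a b L [a, b]) \<subseteq> inversions (xs @ a # b # ys)" "is_fence n (a, b, L)"
    "(a, b) \<notin> inversions (xs @ a # b # ys)"
proof -
  have d: "distinct (xs @ a # b # ys)" and s: "set (xs @ a # b # ys) = {1..n}"
    using w by (auto simp: perms_def)
  have "a \<in> {1..n}" "b \<in> {1..n}" using s by auto
  then show f: "is_fence n (a, b, L)" using ab L by (auto simp: is_fence_def)
  show "(a, b) \<notin> inversions (xs @ a # b # ys)"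
    using bef_asym[OF d, of a b] by (simp add: inversions_iff)
  show "inversions (fence_word n a b L [a, b]) \<subseteq> inversions (xs @ a # b # ys)"
  proof clarify
    fix p q assume pq: "(p, q) \<in> inversions (fence_word n a b L [a, b])"
    have "p \<in> set (xs @ a # b # ys)" if "p \<in> {a<..<b}" for p
      using that s \<open>a \<in> _\<close> \<open>b \<in> _\<close> by auto
    then have "p \<in> set ys" if "p \<in> {a<..<b} - L" for p using that L by auto
    then show "(p, q) \<in> inversions (xs @ a # b # ys)"
      using inversions_fence_word[OF f pq] pq L by (auto simp: inversions_iff)
  qed
qed

text \<open>All edges of a fence are perspective to its canonical lowest edge, so one contracted edge
  contracts the whole fence.\<close>

lemma contracted_edge_iff:
  assumes R: "lattice_congruence n R" and w: "xs @ a # b # ys \<in> perms n" and ab: "a < b"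
  shows "(xs @ a # b # ys, xs @ b # a # ys) \<in> R \<longleftrightarrow>
     (a, b, set xs \<inter> {a<..<b}) \<in> contracted_fences n R"
proof
  define L where "L = set xs \<inter> {a<..<b}"
  let ?lo = "fence_word n a b L [a, b]" and ?hi = "fence_word n a b L [b, a]"
  note f = inversions_fence_word_below(2)[OF w ab L_def]
  have lohi: "?lo \<in> perms n" "?hi \<in> perms n"
    using fence_word_perms[OF f] fence_word_swap_perms[OF f] by blast+
  have hi: "inversions ?hi = insert (a, b) (inversions ?lo)"
    using ab by (rule inversions_fence_word_swap)
  {
    assume e: "(xs @ a # b # ys, xs @ b # a # ys) \<in> R"
    note lo = inversions_fence_word_below(1,3)[OF w ab L_def]
    have *: "inversions u \<subseteq> inversions ?lo"
      if "inversions u \<subseteq> inversions (xs @ a # b # ys)" "inversions u \<subseteq> insert (a, b) (inversions ?lo)" for u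
    proof -
      have "(a, b) \<notin> inversions u" using that(1) lo(2) by (rule contra_subsetD)
      then show ?thesis using that(2) by (simp add: subset_insert)
    qed
    have m1: "is_meet n (xs @ a # b # ys) ?hi ?lo"
      unfolding is_meet_iff hi
      by (intro conjI ballI impI lohi(1) lo(1) subset_insertI; elim conjE; erule (1) *)
    have m2: "is_meet n (xs @ b # a # ys) ?hi ?hi"
      unfolding is_meet_iff hi inversions_swap[OF ab]
      by (intro conjI ballI impI lohi(2) insert_mono lo(1) subset_refl; elim conjE; assumption)
    have lo_hi: "(?lo, ?hi) \<in> R" using cong_meet[OF R e lohi(2) m1 m2] .
    have "(w, w') \<in> R" if e': "fence_edge n (a, b, L) w w'" for w w'
    proof -
      obtain us vs where us: "w = us @ [a, b] @ vs" "w' = us @ [b, a] @ vs" "set us \<inter> {a<..<b} = L"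
        "w \<in> perms n"
        using e' by (auto simp: fence_edge_def)
      then have w2: "us @ a # b # vs \<in> perms n" "us @ b # a # vs \<in> perms n"
        using perms_swap[of us b a vs n] by simp_all
      note lo2 = inversions_fence_word_below(1)[OF w2(1) ab us(3)[symmetric]]
      have "is_join n ?lo (us @ a # b # vs) (us @ a # b # vs)"
        unfolding is_join_iff
        by (intro conjI ballI impI w2(1) lo2 subset_refl; elim conjE; assumption)
      moreover have "is_join n ?hi (us @ a # b # vs) (us @ b # a # vs)"
        unfolding is_join_iff hi inversions_swap[OF ab]
        by (intro conjI ballI impI w2(2) insert_mono lo2 subset_insertI; elim conjE; simp)
      ultimately have "(us @ a # b # vs, us @ b # a # vs) \<in> R"
        using cong_join[OF R lo_hi w2(1)] by blast
      then show ?thesis using us by simp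
    qed
    then show "(a, b, set xs \<inter> {a<..<b}) \<in> contracted_fences n R"
      using f by (simp add: contracted_fences_def L_def)
  }
  assume "(a, b, set xs \<inter> {a<..<b}) \<in> contracted_fences n R"
  moreover have "fence_edge n (a, b, set xs \<inter> {a<..<b}) (xs @ a # b # ys) (xs @ b # a # ys)"
    using w by (auto simp: fence_edge_def)
  ultimately show "(xs @ a # b # ys, xs @ b # a # ys) \<in> R"
    by (simp add: contracted_fences_def)
qed

text \<open>Contracting an edge at the bottom of the hexagon also contracts the opposite edge at the
  top, which belongs to the same fence. A join with the bottom edge and a meet with the top edge
  make larger parts of the two sides equivalent, and convexity singles out the middle edges, where
  \<open>a\<close> and \<open>c\<close> are swapped with \<open>b\<close> on the right or on the
  left.\<close>

lemma contracted_hexagon: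
  assumes R: "lattice_congruence n R" and w: "xs @ a # b # c # ys \<in> perms n" and abc: "a < b" "b < c"
    and f: "(a, b, set xs \<inter> {a<..<b}) \<in> contracted_fences n R \<or>
      (b, c, set xs \<inter> {b<..<c}) \<in> contracted_fences n R"
  shows "(a, c, set xs \<inter> {a<..<c}) \<in> contracted_fences n R"
    "(a, c, insert b (set xs) \<inter> {a<..<c}) \<in> contracted_fences n R"
proof -
  let ?abc = "xs @ a # b # c # ys" and ?bac = "xs @ b # a # c # ys" and ?acb = "xs @ a # c # b # ys"
    and ?bca = "xs @ b # c # a # ys" and ?cab = "xs @ c # a # b # ys" and ?cba = "xs @ c # b # a # ys"
  have p: "?abc \<in> perms n" "?bac \<in> perms n" "?acb \<in> perms n" "?bca \<in> perms n" "?cab \<in> perms n" "?cba \<in> perms n"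
    using w perms_swap[of xs b a "c # ys"] perms_swap[of "xs @ [a]" c b ys] perms_swap[of "xs @ [b]" c a ys]
      perms_swap[of xs c a "b # ys"] perms_swap[of xs c b "a # ys"] by simp_all
  note inv = inversions_hexagon[OF abc refl]
  have le: "weak_le ?abc ?bac" "weak_le ?abc ?acb" "weak_le ?bac ?bca" "weak_le ?bca ?cba"
    "weak_le ?acb ?cab" "weak_le ?cab ?cba" "weak_le ?abc ?bca" "weak_le ?abc ?cab"
    unfolding weak_le_def inv by blast+
  note j = is_join_hexagon[OF w abc] and m = is_meet_hexagon[OF w abc]
  note ja = is_join_absorb[OF _ le(1)] is_join_absorb[OF _ le(2)]
    and ma = is_meet_absorb[OF _ le(4)] is_meet_absorb[OF _ le(6)]
  have edge: "(a, b, set xs \<inter> {a<..<b}) \<in> contracted_fences n R \<Longrightarrow> (?abc, ?bac) \<in> R"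
    "(a, b, set xs \<inter> {a<..<b}) \<in> contracted_fences n R \<Longrightarrow> (?cab, ?cba) \<in> R"
    "(b, c, set xs \<inter> {b<..<c}) \<in> contracted_fences n R \<Longrightarrow> (?abc, ?acb) \<in> R"
    "(b, c, set xs \<inter> {b<..<c}) \<in> contracted_fences n R \<Longrightarrow> (?bca, ?cba) \<in> R"
    using contracted_edge_iff[OF R, of xs a b "c # ys"] contracted_edge_iff[OF R, of "xs @ [c]" a b ys]
      contracted_edge_iff[OF R, of "xs @ [a]" b c ys] contracted_edge_iff[OF R, of xs b c "a # ys"] p abc
    by simp_all
  have "(?acb, ?cab) \<in> R \<and> (?bac, ?bca) \<in> R"
    using f
  proof
    assume *: "(a, b, set xs \<inter> {a<..<b}) \<in> contracted_fences n R"
    have "(?acb, ?cba) \<in> R"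
      using cong_join[OF R edge(1)[OF *] p(3) ja(2)[OF p(3)] j] .
    then have 1: "(?acb, ?cab) \<in> R" using cong_convex(1)[OF R] p le by blast
    have "is_meet n ?cba ?bca ?bca" "is_meet n ?cab ?bca ?abc"
      using ma(1)[OF p(4)] m is_meet_commute by blast+
    then have "(?abc, ?bca) \<in> R" using cong_meet[OF R edge(2)[OF *] p(4)] by blast
    then have "(?bac, ?bca) \<in> R" using cong_convex(2)[OF R] p le by blast
    with 1 show ?thesis by blast
  next
    assume *: "(b, c, set xs \<inter> {b<..<c}) \<in> contracted_fences n R"
    have "(?bac, ?cba) \<in> R"
      using cong_join[OF R edge(3)[OF *] p(2) ja(1)[OF p(2)] is_join_commute[OF j]] .
    then have 1: "(?bac, ?bca) \<in> R" using cong_convex(1)[OF R] p le by blast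
    have "is_meet n ?cba ?cab ?cab"
      using ma(2)[OF p(5)] is_meet_commute by blast
    then have "(?abc, ?cab) \<in> R" using cong_meet[OF R edge(4)[OF *] p(5) m] by blast
    then have "(?acb, ?cab) \<in> R" using cong_convex(2)[OF R] p le by blast
    with 1 show ?thesis by blast
  qed
  then show "(a, c, set xs \<inter> {a<..<c}) \<in> contracted_fences n R"
    "(a, c, insert b (set xs) \<inter> {a<..<c}) \<in> contracted_fences n R"
    using contracted_edge_iff[OF R, of xs a c "b # ys"] contracted_edge_iff[OF R, of "xs @ [b]" a c ys]
      p abc by auto
qed

text \<open>Any word with \<open>a, b, c\<close> consecutive, \<open>L - {b}\<close> before and all
  other values after them carries the required hexagon. Whether \<open>b\<close> belongs to
  \<open>L\<close> decides which of its two middle edges lies in the fence.\<close>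

lemma contracted_extend:
  assumes R: "lattice_congruence n R" and abc: "1 \<le> a" "a < b" "b < c" "c \<le> n" and L: "L \<subseteq> {a<..<c}"
    and f: "(a, b, L \<inter> {a<..<b}) \<in> contracted_fences n R \<or> (b, c, L \<inter> {b<..<c}) \<in> contracted_fences n R"
  shows "(a, c, L) \<in> contracted_fences n R"
proof -
  have "finite L" using L finite_subset by blast
  then obtain xs where xs: "set xs = L - {b}" "distinct xs" using finite_distinct_list[of "L - {b}"] by auto
  obtain ys where ys: "set ys = {1..n} - L - {a, b, c}" "distinct ys"
    using finite_distinct_list[of "{1..n} - L - {a, b, c}"] by auto
  have "xs @ a # b # c # ys \<in> perms n"
  proof -
    have "L \<subseteq> {1..n}" "{a, b, c} \<subseteq> {1..n}" using L abc by auto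
    then have "(L - {b}) \<union> {a, b, c} \<union> ({1..n} - L - {a, b, c}) = {1..n}" by blast
    moreover have "set (xs @ a # b # c # ys) = set xs \<union> {a, b, c} \<union> set ys" by auto
    ultimately have s: "set (xs @ a # b # c # ys) = {1..n}" unfolding xs(1) ys(1) by (rule trans[rotated])
    have "a \<notin> L" "c \<notin> L" "a \<noteq> b" "b \<noteq> c" "a \<noteq> c" using L abc by auto
    then have "distinct (xs @ a # b # c # ys)" using xs ys by auto
    then show ?thesis unfolding perms_def using s by (intro CollectI conjI)
  qed
  moreover have "set xs \<inter> {a<..<b} = L \<inter> {a<..<b}"
    unfolding xs(1) by auto
  moreover have "set xs \<inter> {b<..<c} = L \<inter> {b<..<c}"
    unfolding xs(1) by auto
  ultimately have *: "(a, c, set xs \<inter> {a<..<c}) \<in> contracted_fences n R"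
    "(a, c, insert b (set xs) \<inter> {a<..<c}) \<in> contracted_fences n R"
    using contracted_hexagon[OF R _ abc(2,3), of xs ys] f by simp_all
  have "L = set xs \<inter> {a<..<c} \<or> L = insert b (set xs) \<inter> {a<..<c}"
    using xs L abc by (cases "b \<in> L") auto
  then show ?thesis using * by metis
qed

text \<open>The downset part of Reading's theorem, obtained by moving the right end from
  \<open>d\<close> to \<open>b\<close> and then the left end from \<open>c\<close> to
  \<open>a\<close>.\<close>

lemma contracted_downset:
  assumes R: "lattice_congruence n R" and c: "(c, d, L \<inter> {c<..<d}) \<in> contracted_fences n R"
    and ab: "1 \<le> a" "a \<le> c" "d \<le> b" "b \<le> n" and L: "L \<subseteq> {a<..<b}"
  shows "(a, b, L) \<in> contracted_fences n R"
proof -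
  have cd: "c < d" using c by (auto simp: contracted_fences_def is_fence_def)
  have 1: "(c, b, L \<inter> {c<..<b}) \<in> contracted_fences n R"
  proof (cases "d = b")
    case False
    have "L \<inter> {c<..<b} \<inter> {c<..<d} = L \<inter> {c<..<d}" using ab by auto
    then show ?thesis using contracted_extend[OF R, of c d b "L \<inter> {c<..<b}"] False ab cd c by auto
  qed (use c in simp)
  show ?thesis
  proof (cases "a = c")
    case True
    then show ?thesis using 1 L by (simp add: Int_absorb2)
  next
    case False
    then show ?thesis using contracted_extend[OF R, of a c b L] ab cd 1 L by auto
  qed
qed

text \<open>By \<open>contracted_downset\<close>, for \<open>1 \<le> a\<close> and
  \<open>b \<le> n\<close> this is contraction of the fence of \<open>a\<close>, \<open>b\<close>
  with left set \<open>X\<close> cut down to \<open>]a, b[\<close>. In the existential form,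
  monotonicity in the interval is immediate and \<open>X\<close> may be the set of all letters to
  the left.\<close>

definition contracts :: "nat \<Rightarrow> (nat list \<times> nat list) set \<Rightarrow> nat \<Rightarrow> nat \<Rightarrow> nat set \<Rightarrow> bool" where
  "contracts n R a b X \<longleftrightarrow> (\<exists>c d. a \<le> c \<and> d \<le> b \<and> (c, d, X \<inter> {c<..<d}) \<in> contracted_fences n R)"

lemma contracts_edge_iff:
  assumes R: "lattice_congruence n R" and w: "xs @ a # b # ys \<in> perms n" and ab: "a < b"
  shows "(xs @ a # b # ys, xs @ b # a # ys) \<in> R \<longleftrightarrow> contracts n R a b (set xs)"
proof -
  have "set (xs @ a # b # ys) = {1..n}" using w by (simp add: perms_def)
  then have n: "1 \<le> a" "b \<le> n" by auto
  have "(a, b, set xs \<inter> {a<..<b}) \<in> contracted_fences n R \<longleftrightarrow> contracts n R a b (set xs)"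
  proof
    assume "contracts n R a b (set xs)"
    then obtain c d where cd: "a \<le> c" "d \<le> b" "(c, d, set xs \<inter> {c<..<d}) \<in> contracted_fences n R"
      by (auto simp: contracts_def)
    moreover have "set xs \<inter> {a<..<b} \<inter> {c<..<d} = set xs \<inter> {c<..<d}" using cd by auto
    ultimately show "(a, b, set xs \<inter> {a<..<b}) \<in> contracted_fences n R"
      using contracted_downset[OF R, of c d "set xs \<inter> {a<..<b}" a b] n by simp
  qed (auto simp: contracts_def)
  then show ?thesis using contracted_edge_iff[OF R w ab] by simp
qed

section \<open>Minimal and maximal words\<close>

text \<open>All that the arguments on words use of a congruence: \<open>con_mono\<close> is the
  downset property, \<open>con_cong\<close> says that only the values between matter, and
  \<open>con_Suc\<close> is essentiality. Words range over any values, so letters can be deleted at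
  both ends of the value range.\<close>

locale contraction =
  fixes con :: "nat \<Rightarrow> nat \<Rightarrow> nat set \<Rightarrow> bool"
  assumes con_less: "con a b X \<Longrightarrow> a < b"
    and con_mono: "con c d X \<Longrightarrow> a \<le> c \<Longrightarrow> d \<le> b \<Longrightarrow> con a b X"
    and con_cong: "con a b X \<Longrightarrow> X \<inter> {a<..<b} = Y \<inter> {a<..<b} \<Longrightarrow> con a b Y"
    and con_Suc: "\<not> con k (Suc k) X"
begin

definition step :: "nat list \<Rightarrow> nat list \<Rightarrow> bool" where
  "step w z \<longleftrightarrow> (\<exists>xs a b ys. w = xs @ a # b # ys \<and> z = xs @ b # a # ys \<and> con a b (set xs))"

text \<open>Local minimality; within a congruence class it characterizes the least element
  (\<open>least_cmin\<close>, \<open>cmin_least\<close>).\<close>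

definition cmin :: "nat list \<Rightarrow> bool" where
  "cmin w \<longleftrightarrow> (\<forall>xs a b ys. w = xs @ b # a # ys \<longrightarrow> \<not> con a b (set xs))"

definition cmax :: "nat list \<Rightarrow> bool" where
  "cmax w \<longleftrightarrow> (\<forall>xs a b ys. w = xs @ a # b # ys \<longrightarrow> \<not> con a b (set xs))"

lemma cminD: "cmin (xs @ b # a # ys) \<Longrightarrow> \<not> con a b (set xs)"
  unfolding cmin_def by blast

lemma cmaxD: "cmax (xs @ a # b # ys) \<Longrightarrow> \<not> con a b (set xs)"
  unfolding cmax_def by blast

lemma step_set: "step w z \<Longrightarrow> set z = set w"
  by (auto simp: step_def)

lemma step_distinct: "step w z \<Longrightarrow> distinct z \<longleftrightarrow> distinct w"
  by (auto simp: step_def)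

lemma steps_set: "step\<^sup>*\<^sup>* w z \<Longrightarrow> set z = set w \<and> distinct z = distinct w"
proof (induction rule: rtranclp_induct)
  case (step y z)
  then show ?case using step_set[of y z] step_distinct[of y z] by simp
qed simp

lemma con_insert_left: "p \<le> a \<or> b \<le> p \<Longrightarrow> con a b (insert p X) \<longleftrightarrow> con a b X"
proof -
  assume "p \<le> a \<or> b \<le> p"
  then have "insert p X \<inter> {a<..<b} = X \<inter> {a<..<b}" by auto
  then show ?thesis using con_cong by metis
qed

text \<open>With \<open>P = (\<lambda>p. con p N)\<close>, \<open>cuts P X w\<close> lists the values of \<open>w\<close> which a maximal value \<open>N\<close>
  cannot cross by a contracted edge, and \<open>N\<close> itself; \<open>X\<close> accumulates the values to the left.\<close>

fun cuts :: "(nat \<Rightarrow> nat set \<Rightarrow> bool) \<Rightarrow> nat set \<Rightarrow> nat list \<Rightarrow> nat list" where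
  "cuts P X [] = []"
| "cuts P X (p # ps) = (if P p X then [] else [p]) @ cuts P (insert p X) ps"

lemma cuts_append: "cuts P X (xs @ ys) = cuts P X xs @ cuts P (X \<union> set xs) ys"
  by (induction xs arbitrary: X) auto

lemma cuts_subset: "set (cuts P X xs) \<subseteq> set xs"
  by (induction xs arbitrary: X) auto

lemma cuts_NilD: "cuts P X (ys @ y # zs) = [] \<Longrightarrow> P y (X \<union> set ys)"
  by (auto simp: cuts_append split: if_splits)

lemma cuts_last:
  "cuts P X w \<noteq> [] \<Longrightarrow> \<exists>w1 w2. w = w1 @ last (cuts P X w) # w2 \<and>
     cuts P (insert (last (cuts P X w)) (X \<union> set w1)) w2 = []"
proof (induction w rule: rev_induct)
  case (snoc x w)
  show ?case
  proof (cases "P x (X \<union> set w)")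
    case True
    then have e: "cuts P X (w @ [x]) = cuts P X w" by (simp add: cuts_append)
    then obtain w1 w2 where w: "w = w1 @ last (cuts P X w) # w2"
      "cuts P (insert (last (cuts P X w)) (X \<union> set w1)) w2 = []"
      using snoc by auto
    have "set w = insert (last (cuts P X w)) (set w1 \<union> set w2)" by (subst w(1)) auto
    then have "cuts P (insert (last (cuts P X w)) (X \<union> set w1)) (w2 @ [x]) = []"
      using w(2) True by (simp add: cuts_append Un_assoc)
    then show ?thesis unfolding e using w(1) by (metis append.assoc append_Cons)
  next
    case False
    then show ?thesis by (intro exI[of _ w] exI[of _ "[]"]) (simp add: cuts_append)
  qed
qed simp

lemma cuts_first:
  "cuts P X w \<noteq> [] \<Longrightarrow> \<exists>w1 w2. w = w1 @ hd (cuts P X w) # w2 \<and> cuts P X w1 = []"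
proof (induction w arbitrary: X)
  case (Cons x w)
  show ?case
  proof (cases "P x X")
    case True
    then have e: "cuts P X (x # w) = cuts P (insert x X) w" by simp
    then obtain w1 w2 where w: "w = w1 @ hd (cuts P (insert x X) w) # w2" "cuts P (insert x X) w1 = []"
      using Cons.IH[of "insert x X"] Cons.prems by metis
    then have "x # w = (x # w1) @ hd (cuts P X (x # w)) # w2" "cuts P X (x # w1) = []"
      using True e by auto
    then show ?thesis by blast
  next
    case False
    then show ?thesis by (intro exI[of _ "[]"] exI[of _ w]) simp
  qed
qed simp

text \<open>\<open>N\<close> is itself a cut and occurs once, so it marks the same place in both
  lists.\<close>

lemma cuts_split:
  assumes e: "cuts P {} (v1 @ N # v2) = cuts P {} (u1 @ N # u2)" and NN: "\<And>X. \<not> P N X"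
    and d: "distinct (u1 @ N # u2)" "distinct (v1 @ N # v2)"
  shows "cuts P {} v1 = cuts P {} u1" "cuts P (insert N (set v1)) v2 = cuts P (insert N (set u1)) u2"
proof -
  let ?A = "cuts P {} v1" and ?B = "cuts P (insert N (set v1)) v2"
    and ?C = "cuts P {} u1" and ?D = "cuts P (insert N (set u1)) u2"
  have "?A @ N # ?B = ?C @ N # ?D"
    using e NN by (simp add: cuts_append)
  moreover have "N \<notin> set ?A" "N \<notin> set ?B" "N \<notin> set ?C" "N \<notin> set ?D"
    using d cuts_subset by fastforce+
  ultimately show "?A = ?C" "?B = ?D"
    by (metis append_Cons_eq_iff)+
qed

abbreviation con_to :: "nat \<Rightarrow> nat \<Rightarrow> nat set \<Rightarrow> bool" where
  "con_to N \<equiv> \<lambda>p. con p N"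

text \<open>In a contracted pair \<open>a < b\<close>, the letter \<open>a\<close> is a non-cut
  before and after the swap by \<open>con_mono\<close>, and the status of \<open>b\<close> does not
  depend on the smaller letter \<open>a\<close>.\<close>

lemma cuts_step:
  assumes s: "step w z" and N: "\<forall>x\<in>set w. x \<le> N"
  shows "cuts (con_to N) {} z = cuts (con_to N) {} w"
proof -
  from s obtain xs a b ys where w: "w = xs @ a # b # ys" "z = xs @ b # a # ys" and c: "con a b (set xs)"
    unfolding step_def by blast
  have ab: "a < b" using c by (rule con_less)
  have bN: "b \<le> N" using N w by simp
  have NN: "\<not> con N N X" for X using con_less by blast
  have "con a b (insert b (set xs))" using c con_insert_left[of b a b] by simp
  then have "con a N (set xs)" "con a N (insert b (set xs))"
    using con_mono[OF _ order_refl bN] c by blast+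
  moreover have "con b N (insert a (set xs)) = con b N (set xs)"
    using con_insert_left[of a b] ab by simp
  ultimately have "cuts (con_to N) (set xs) [a, b] = cuts (con_to N) (set xs) [b, a]"
    by simp
  moreover have "cuts (con_to N) (set xs) ([a, b] @ ys) = cuts (con_to N) (set xs) ([b, a] @ ys)"
    unfolding cuts_append calculation by (simp add: insert_commute)
  ultimately show ?thesis using w by (simp add: cuts_append)
qed

lemma cuts_steps:
  "step\<^sup>*\<^sup>* w z \<Longrightarrow> \<forall>x\<in>set w. x \<le> N \<Longrightarrow> cuts (con_to N) {} z = cuts (con_to N) {} w"
proof (induction rule: rtranclp_induct)
  case (step y z)
  then show ?case using cuts_step[of y z N] steps_set[of w y] by simp
qed simp

section \<open>Deleting an extreme value\<close>

text \<open>An extreme value never lies strictly between two others. Deleting it leaves the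
  remaining edges contracted and collapses its own edges to a point.\<close>

lemma step_remove_max:
  assumes s: "step w z" and N: "\<forall>x\<in>set w. x \<le> N"
  shows "step (filter (\<lambda>x. x \<noteq> N) w) (filter (\<lambda>x. x \<noteq> N) z) \<or> filter (\<lambda>x. x \<noteq> N) w = filter (\<lambda>x. x \<noteq> N) z"
proof -
  from s obtain xs a b ys where w: "w = xs @ a # b # ys" "z = xs @ b # a # ys" and c: "con a b (set xs)"
    unfolding step_def by blast
  have ab: "a < b" "b \<le> N" using c con_less N w by auto
  show ?thesis
  proof (cases "b = N")
    case False
    have "set (filter (\<lambda>x. x \<noteq> N) xs) \<inter> {a<..<b} = set xs \<inter> {a<..<b}" using ab by auto
    then have "con a b (set (filter (\<lambda>x. x \<noteq> N) xs))" using c con_cong by metis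
    then show ?thesis using w ab False unfolding step_def
      by (intro disjI1 exI[of _ "filter (\<lambda>x. x \<noteq> N) xs"] exI[of _ a] exI[of _ b] exI[of _ "filter (\<lambda>x. x \<noteq> N) ys"]) simp
  qed (use w ab in simp)
qed

lemma step_remove_min:
  assumes s: "step w z" and N: "\<forall>x\<in>set w. N \<le> x"
  shows "step (filter (\<lambda>x. x \<noteq> N) w) (filter (\<lambda>x. x \<noteq> N) z) \<or> filter (\<lambda>x. x \<noteq> N) w = filter (\<lambda>x. x \<noteq> N) z"
proof -
  from s obtain xs a b ys where w: "w = xs @ a # b # ys" "z = xs @ b # a # ys" and c: "con a b (set xs)"
    unfolding step_def by blast
  have ab: "a < b" "N \<le> a" using c con_less N w by auto
  show ?thesis
  proof (cases "a = N")
    case False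
    have "set (filter (\<lambda>x. x \<noteq> N) xs) \<inter> {a<..<b} = set xs \<inter> {a<..<b}" using ab by auto
    then have "con a b (set (filter (\<lambda>x. x \<noteq> N) xs))" using c con_cong by metis
    then show ?thesis using w ab False unfolding step_def
      by (intro disjI1 exI[of _ "filter (\<lambda>x. x \<noteq> N) xs"] exI[of _ a] exI[of _ b] exI[of _ "filter (\<lambda>x. x \<noteq> N) ys"]) simp
  qed (use w ab in simp)
qed

lemma steps_remove:
  assumes st: "step\<^sup>*\<^sup>* w z"
    and N: "(\<forall>x\<in>set w. x \<le> N) \<or> (\<forall>x\<in>set w. N \<le> x)"
  shows "step\<^sup>*\<^sup>* (filter (\<lambda>x. x \<noteq> N) w) (filter (\<lambda>x. x \<noteq> N) z)"
  using st
proof (induction rule: rtranclp_induct)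
  case (step y z)
  have y: "set y = set w" using steps_set[OF step(1)] by blast
  have "step (filter (\<lambda>x. x \<noteq> N) y) (filter (\<lambda>x. x \<noteq> N) z) \<or> filter (\<lambda>x. x \<noteq> N) y = filter (\<lambda>x. x \<noteq> N) z"
    using step_remove_max[OF step(2), of N] step_remove_min[OF step(2), of N] N y by auto
  then show ?case
  proof
    assume "filter (\<lambda>x. x \<noteq> N) y = filter (\<lambda>x. x \<noteq> N) z"
    then show ?thesis using step.IH by simp
  qed (use step.IH in \<open>rule rtranclp.rtrancl_into_rtrancl\<close>)
qed simp

lemma steps_remove_at:
  assumes "step\<^sup>*\<^sup>* (u1 @ N # u2) (v1 @ N # v2)" "distinct (u1 @ N # u2)"
    and "(\<forall>x\<in>set (u1 @ N # u2). x \<le> N) \<or> (\<forall>x\<in>set (u1 @ N # u2). N \<le> x)"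
  shows "step\<^sup>*\<^sup>* (u1 @ u2) (v1 @ v2)"
proof -
  have "distinct (v1 @ N # v2)" using steps_set[OF assms(1)] assms(2) by blast
  moreover have "filter (\<lambda>x. x \<noteq> N) w = w" if "N \<notin> set w" for w
    using that by (intro filter_True) auto
  ultimately have "filter (\<lambda>x. x \<noteq> N) (u1 @ N # u2) = u1 @ u2" "filter (\<lambda>x. x \<noteq> N) (v1 @ N # v2) = v1 @ v2"
    using assms(2) by auto
  then show ?thesis using steps_remove[OF assms(1,3)] by simp
qed

lemma adjacent_append_cases:
  assumes "u1 @ u2 = xs @ a # b # ys"
  obtains zs where "u1 = xs @ a # b # zs" "ys = zs @ u2"
  | zs where "u2 = zs @ a # b # ys" "xs = u1 @ zs"
  | "u1 = xs @ [a]" "u2 = b # ys"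
  using assms by (auto simp: append_eq_append_conv2 Cons_eq_append_conv append_eq_Cons_conv)

lemma con_insert_max: "b \<le> N \<Longrightarrow> con a b (insert N X) \<longleftrightarrow> con a b X"
  by (simp add: con_insert_left)

text \<open>In \<open>b, N, a\<close> the pair \<open>b, a\<close> becomes adjacent. Its contraction
  would by \<open>con_mono\<close> contract the descent \<open>N, a\<close> of the original word.
  For the other adjacent pairs the left set changes at most by \<open>N\<close>, which is outside
  the interval.\<close>

lemma cmin_remove_max:
  assumes c: "cmin (u1 @ N # u2)" and N: "\<forall>x\<in>set (u1 @ N # u2). x \<le> N"
  shows "cmin (u1 @ u2)"
  unfolding cmin_def
proof (intro allI impI)
  fix xs a b ys assume e: "u1 @ u2 = xs @ b # a # ys"
  then have b: "b \<in> set (u1 @ u2)" by simp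
  then have bN: "b \<le> N" using N by auto
  from e show "\<not> con a b (set xs)"
  proof (cases rule: adjacent_append_cases)
    case (1 zs)
    then show ?thesis using cminD[of xs b a "zs @ N # u2"] c by simp
  next
    case (2 zs)
    then have "\<not> con a b (insert N (set xs))" using cminD[of "u1 @ N # zs" b a ys] c by simp
    then show ?thesis using bN con_insert_max by blast
  next
    case 3
    then have "\<not> con a N (insert b (set xs))" using cminD[of "xs @ [b]" N a ys] c by simp
    moreover have "con a N (insert b (set xs))" if "con a b (set xs)"
      using con_mono[OF _ order_refl bN, of a "insert b (set xs)"] that con_insert_max[of b b] by simp
    ultimately show ?thesis by blast
  qed
qed

lemma cmax_remove_max:
  assumes c: "cmax (u1 @ N # u2)" and N: "\<forall>x\<in>set (u1 @ N # u2). x \<le> N"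
  shows "cmax (u1 @ u2)"
  unfolding cmax_def
proof (intro allI impI)
  fix xs a b ys assume e: "u1 @ u2 = xs @ a # b # ys"
  then have b: "b \<in> set (u1 @ u2)" by simp
  then have bN: "b \<le> N" using N by auto
  from e show "\<not> con a b (set xs)"
  proof (cases rule: adjacent_append_cases)
    case (1 zs)
    then show ?thesis using cmaxD[of xs a b "zs @ N # u2"] c by simp
  next
    case (2 zs)
    then have "\<not> con a b (insert N (set xs))" using cmaxD[of "u1 @ N # zs" a b ys] c by simp
    then show ?thesis using bN con_insert_max by blast
  next
    case 3
    then have "\<not> con a N (set xs)" using cmaxD[of xs a N u2] c by simp
    then show ?thesis using con_mono[OF _ order_refl bN] by blast
  qed
qed

lemma cmax_remove_min:
  assumes c: "cmax (u1 @ N # u2)" and N: "\<forall>x\<in>set (u1 @ N # u2). N \<le> x"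
  shows "cmax (u1 @ u2)"
  unfolding cmax_def
proof (intro allI impI)
  fix xs a b ys assume e: "u1 @ u2 = xs @ a # b # ys"
  then have "a \<in> set (u1 @ u2)" by simp
  then have aN: "N \<le> a" using N by auto
  from e show "\<not> con a b (set xs)"
  proof (cases rule: adjacent_append_cases)
    case (1 zs)
    then show ?thesis using cmaxD[of xs a b "zs @ N # u2"] c by simp
  next
    case (2 zs)
    then have "\<not> con a b (insert N (set xs))" using cmaxD[of "u1 @ N # zs" a b ys] c by simp
    then show ?thesis using aN con_insert_left by blast
  next
    case 3
    then have "\<not> con N b (insert a (set xs))" using cmaxD[of "xs @ [a]" N b ys] c by simp
    moreover have "con N b (insert a (set xs))" if "con a b (set xs)"
      using con_mono[OF _ aN order_refl, of b "insert a (set xs)"] that con_insert_left[of a a] by simp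
    ultimately show ?thesis by blast
  qed
qed

section \<open>Descents and the position of the largest value\<close>

text \<open>Put at the front of a nonempty word or into an ascent, \<open>N\<close> adds one
  descent; put into a descent or at the end, it adds none. Equal neighbours behave like an
  ascent.\<close>

lemma des_remove_max:
  assumes "\<forall>x\<in>set (u1 @ u2). x < N"
  shows "des (u1 @ N # u2) = des (u1 @ u2) + (if u2 \<noteq> [] \<and> (u1 \<noteq> [] \<longrightarrow> last u1 < hd u2 \<or> last u1 = hd u2) then 1 else 0)"
proof (cases u2)
  case Nil
  show ?thesis
  proof (cases u1 rule: rev_cases)
    case (snoc xs x)
    then show ?thesis using Nil assms des_append[of xs x N "[]"] by simp
  qed (use Nil in simp)
next
  case (Cons y ys)
  show ?thesis
  proof (cases u1 rule: rev_cases)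
    case Nil
    then show ?thesis using Cons assms by simp
  next
    case (snoc xs x)
    then show ?thesis using Cons assms des_append[of xs x N "y # ys"] des_append[of xs x y ys] by auto
  qed
qed

text \<open>The letter before \<open>N\<close> forms an ascent with it, and in a maximal word no
  ascent is contracted. Dually, in a minimal word the letter after \<open>N\<close> is a
  cut.\<close>

lemma cut_before_max:
  assumes "cmax (v1 @ N # v2)" "v1 \<noteq> []"
  shows "cuts (con_to N) {} v1 \<noteq> [] \<and> last (cuts (con_to N) {} v1) = last v1 \<and> \<not> con (last v1) N (set (butlast v1))"
proof -
  have e: "v1 = butlast v1 @ [last v1]" using assms(2) by simp
  then have "\<not> con (last v1) N (set (butlast v1))"
    using cmaxD[of "butlast v1" "last v1" N v2] assms(1) by (metis append.assoc append_Cons append_Nil)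
  moreover have "cuts (con_to N) {} v1 = cuts (con_to N) {} (butlast v1) @ cuts (con_to N) (set (butlast v1)) [last v1]"
    using cuts_append[of "con_to N" "{}" "butlast v1" "[last v1]"] e by simp
  ultimately show ?thesis by simp
qed

lemma cut_after_min:
  assumes "cmin (u1 @ N # u2)" "u2 \<noteq> []"
  shows "\<not> con (hd u2) N (set u1)"
proof -
  have "u2 = hd u2 # tl u2" using assms(2) by simp
  then show ?thesis using cminD[of u1 N "hd u2" "tl u2"] assms(1) by metis
qed

text \<open>For a fixed left set, \<open>con_mono\<close> passes the cut property on to larger
  values. So a non-cut directly after a cut cannot exceed it, and neither can one directly before a
  cut (\<open>con_prev_less\<close>).\<close>

lemma con_next_less:
  assumes "\<not> con p N X" "con q N (insert p X)"
  shows "q \<le> p"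
proof (rule ccontr)
  assume "\<not> q \<le> p"
  then have "con p N (insert p X)" using con_mono[OF assms(2)] by simp
  then show False using assms(1) con_insert_left[of p p] by simp
qed

lemma con_prev_less:
  assumes "con p N X" "\<not> con q N (insert p X)"
  shows "p \<le> q"
proof (rule ccontr)
  assume "\<not> p \<le> q"
  moreover have "con p N (insert p X)" using assms(1) con_insert_left[of p p] by simp
  ultimately show False using assms(2) con_mono by auto
qed

text \<open>By essentiality \<open>Suc m\<close> can never cross \<open>m\<close>, so
  \<open>m\<close> is a cut on one of the two sides.\<close>

lemma pred_in_cuts:
  assumes "m \<in> set (u1 @ u2)"
  shows "cuts (con_to (Suc m)) {} u1 \<noteq> [] \<or> cuts (con_to (Suc m)) (insert (Suc m) (set u1)) u2 \<noteq> []"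
proof -
  have "m \<in> set (cuts (con_to (Suc m)) X w)" if "m \<in> set w" for X w
    using that con_Suc by (induction w arbitrary: X) auto
  then have "m \<in> set (cuts (con_to (Suc m)) {} u1) \<or> m \<in> set (cuts (con_to (Suc m)) (insert (Suc m) (set u1)) u2)"
    using assms unfolding set_append by blast
  then show ?thesis by auto
qed

text \<open>The letter before \<open>N\<close> is a cut by maximality and the letter after it, if
  any, is a non-cut. Hence \<open>N\<close> stands in a descent or at the end.\<close>

lemma des_remove_max_cuts_Nil:
  assumes c: "cmax (v1 @ N # v2)" and d: "distinct (v1 @ N # v2)"
    and N: "\<forall>x\<in>set (v1 @ v2). x < N"
    and Nil: "cuts (con_to N) (insert N (set v1)) v2 = []" and ne: "cuts (con_to N) {} v1 \<noteq> []"
  shows "des (v1 @ N # v2) = des (v1 @ v2)"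
proof (cases v2)
  case Nil
  then show ?thesis using des_remove_max[OF N] by simp
next
  case (Cons q qs)
  have v1: "v1 \<noteq> []" using ne by auto
  then have s: "set v1 = insert (last v1) (set (butlast v1))"
    by (metis append_butlast_last_id list.simps(15) rotate1.simps(2) set_rotate1)
  have "con q N (insert N (set v1))" using Nil Cons by (auto split: if_splits)
  then have "con q N (insert (last v1) (set (butlast v1)))" using con_insert_max s by simp
  then have "q \<le> last v1" using con_next_less cut_before_max[OF c v1] by blast
  moreover have "q \<noteq> last v1" using d v1 Cons by auto
  ultimately show ?thesis using des_remove_max[OF N] Cons v1 by auto
qed

text \<open>With \<open>Suc m\<close> at the end no cut lies to its right, and this persists along
  steps; the cut \<open>m\<close> lies to its left. So \<open>des_remove_max_cuts_Nil\<close>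
  applies to \<open>v\<close>.\<close>

lemma des_snoc_max:
  assumes st: "step\<^sup>*\<^sup>* (u1 @ [Suc m]) v" and c: "cmax v" and d: "distinct (u1 @ [Suc m])"
    and N: "\<forall>x\<in>set u1. x < Suc m" and m: "m \<in> set u1"
  shows "\<exists>v'. step\<^sup>*\<^sup>* u1 v' \<and> cmax v' \<and> des v' = des v"
proof -
  have sv: "set v = set (u1 @ [Suc m])" "distinct v" using steps_set[OF st] d by auto
  then obtain v1 v2 where v: "v = v1 @ Suc m # v2" by (metis split_list in_set_conv_decomp)
  have le: "\<forall>x\<in>set (u1 @ [Suc m]). x \<le> Suc m" using N by auto
  have cu: "cuts (con_to (Suc m)) {} v1 = cuts (con_to (Suc m)) {} u1" "cuts (con_to (Suc m)) (insert (Suc m) (set v1)) v2 = []"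
    using cuts_split[of "con_to (Suc m)" v1 "Suc m" v2 u1 "[]"] cuts_steps[OF st le] con_less d sv(2) v by auto
  have ne: "cuts (con_to (Suc m)) {} v1 \<noteq> []" using pred_in_cuts[of m u1 "[]"] m cu by simp
  have lev: "\<forall>x\<in>set (v1 @ Suc m # v2). x \<le> Suc m" using le unfolding sv(1)[symmetric] v .
  have lt: "\<forall>x\<in>set (v1 @ v2). x < Suc m"
  proof
    fix x assume x: "x \<in> set (v1 @ v2)"
    then have "x \<noteq> Suc m" "x \<le> Suc m" using lev sv(2) v by auto
    then show "x < Suc m" by simp
  qed
  have "des v = des (v1 @ v2)"
    using des_remove_max_cuts_Nil[OF _ _ lt cu(2) ne] c sv(2) v by simp
  moreover have "step\<^sup>*\<^sup>* u1 (v1 @ v2)"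
    using steps_remove_at[of u1 "Suc m" "[]" v1 v2] st d le v by simp
  moreover have "cmax (v1 @ v2)"
    using cmax_remove_max[OF _ lev] c v by simp
  ultimately show ?thesis by auto
qed

text \<open>The next two lemmas are the only places where simplicity is needed.\<close>

lemma adjacent_cuts_cmin:
  assumes simple: "\<And>a b X. con a b X \<Longrightarrow>
      \<exists>c d. a \<le> c \<and> d \<le> b \<and> con c d X \<and> (X \<inter> {c<..<d} = {} \<or> {c<..<d} \<subseteq> X)"
    and c: "cmin (xs @ p # ys @ q # zs)" and d: "distinct (xs @ p # ys @ q # zs)"
    and q: "\<not> con q N (set (xs @ p # ys))" and ys: "cuts (con_to N) (set (xs @ [p])) ys = []"
    and pq: "p > q"
  shows "ys = []"
proof (rule ccontr)
  assume ne: "ys \<noteq> []"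
  have noncut: "con y N (set (xs @ p # us))" if "ys = us @ y # vs" for us y vs
    using cuts_NilD[of "con_to N" "set (xs @ [p])" us y vs] ys that by simp
  have "\<exists>x\<in>set (p # ys). x > q" using pq by auto
  \<comment> \<open>\<open>x\<close> is the last letter above \<open>q\<close>. By
    \<open>con_prev_less\<close> it is not the letter directly before \<open>q\<close>, so it is
    followed by some non-cut \<open>y < q\<close>, and the descent \<open>x, y\<close> straddles
    \<open>q\<close>.\<close>
  then obtain us x vs where x: "p # ys = us @ x # vs" "x > q" "\<forall>z\<in>set vs. \<not> z > q"
    using split_list_last_prop[of "p # ys" "\<lambda>x. x > q"] by auto
  have "vs \<noteq> []"
  proof
    assume "vs = []"
    then have l: "x = last ys" "ys = butlast ys @ [x]" using x(1) ne by (metis last.simps last_snoc, metis append_butlast_last_id last.simps last_snoc)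
    then have "con x N (set (xs @ p # butlast ys))" using noncut by metis
    moreover have "set (xs @ p # ys) = insert x (set (xs @ p # butlast ys))"
      by (subst l(2)) auto
    ultimately show False using con_prev_less q x(2) by (metis not_less)
  qed
  then obtain y vs' where vs: "vs = y # vs'" by (cases vs) auto
  have word: "xs @ p # ys @ q # zs = (xs @ us) @ x # y # vs' @ q # zs"
    using x(1) vs by (metis append.assoc append_Cons)
  have "x \<noteq> q" "y \<noteq> q" "q \<notin> set (xs @ us @ [x])" "q \<notin> set vs'" using d unfolding word by auto
  then have y: "y < q" "\<forall>z\<in>set vs. z < q" using x(3) vs by (auto simp: not_less order.strict_iff_order)
  let ?X = "insert x (set (xs @ us))"
  have "con y N ?X"
  proof (cases us)
    case Nil
    then show ?thesis using x(1) vs noncut[of "[]" y vs'] by simp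
  next
    case (Cons p' us')
    then have "p' = p" "ys = (us' @ [x]) @ y # vs'" using x(1) vs by auto
    then show ?thesis using noncut[of "us' @ [x]" y vs'] Cons by (simp add: insert_commute)
  qed
  \<comment> \<open>The contraction of \<open>y\<close>, \<open>N\<close> is shrunk to a simple one.
    Minimality at \<open>x, y\<close> forces \<open>x < f\<close>, and \<open>q\<close> being a cut
    forces \<open>e < q\<close>. Then \<open>q < x\<close> both lie strictly inside,
    \<open>x\<close> on the left and \<open>q\<close> on the right.\<close>
  then obtain e f where ef: "y \<le> e" "f \<le> N" "con e f ?X" "?X \<inter> {e<..<f} = {} \<or> {e<..<f} \<subseteq> ?X"
    using simple by blast
  have nyx: "\<not> con y x ?X"
    using cminD[of "xs @ us" x y "vs' @ q # zs"] c con_insert_left[of x y x] unfolding word by auto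
  have "x < f" using con_mono[OF ef(3,1), of x] nyx by (meson not_less)
  moreover have "e < q"
  proof (rule ccontr)
    assume "\<not> e < q"
    then have "con q N ?X" using con_mono[OF ef(3) _ ef(2), of q] by simp
    moreover have "?X \<inter> {q<..<N} = set (xs @ p # ys) \<inter> {q<..<N}"
    proof -
      have "set (xs @ p # ys) = set xs \<union> set (p # ys)" by auto
      then have "set (xs @ p # ys) = ?X \<union> set vs" unfolding x(1) by auto
      then show ?thesis using y(2) by auto
    qed
    ultimately show False using con_cong q by blast
  qed
  ultimately have "x \<in> ?X \<inter> {e<..<f}" "q \<in> {e<..<f}" using x(2) by auto
  then show False using ef(4) \<open>q \<notin> set (xs @ us @ [x])\<close> by auto
qed

lemma adjacent_cuts_cmax:
  assumes simple: "\<And>a b X. con a b X \<Longrightarrow>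
      \<exists>c d. a \<le> c \<and> d \<le> b \<and> con c d X \<and> (X \<inter> {c<..<d} = {} \<or> {c<..<d} \<subseteq> X)"
    and c: "cmax (xs @ p # ys @ q # zs)" and d: "distinct (xs @ p # ys @ q # zs)"
    and p: "\<not> con p N (set xs)" and ys: "cuts (con_to N) (set (xs @ [p])) ys = []"
    and pq: "p < q"
  shows "ys = []"
proof (rule ccontr)
  assume ne: "ys \<noteq> []"
  have noncut: "con y N (set (xs @ p # us))" if "ys = us @ y # vs" for us y vs
    using cuts_NilD[of "con_to N" "set (xs @ [p])" us y vs] ys that by simp
  have "\<exists>x\<in>set (ys @ [q]). x > p" using pq by auto
  \<comment> \<open>\<open>x\<close> is the first letter above \<open>p\<close>. By
    \<open>con_next_less\<close> it does not directly follow \<open>p\<close>, so it is preceded by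
    a non-cut \<open>y < p\<close>.\<close>
  then obtain us x vs where x: "ys @ [q] = us @ x # vs" "x > p" "\<forall>z\<in>set us. \<not> z > p"
    using split_list_first_prop[of "ys @ [q]" "\<lambda>x. x > p"] by auto
  have "us \<noteq> []"
  proof
    assume "us = []"
    then obtain ys' where "ys = x # ys'" using x(1) ne by (cases ys) auto
    then have "con x N (insert p (set xs))" using noncut[of "[]" x ys'] by simp
    then show False using con_next_less[OF p] x(2) by fastforce
  qed
  then obtain us' y where us: "us = us' @ [y]" by (cases us rule: rev_cases) auto
  have word: "xs @ p # ys @ q # zs = (xs @ p # us') @ y # x # vs @ zs"
  proof -
    have "xs @ p # ys @ q # zs = xs @ p # (ys @ [q]) @ zs" by simp
    then show ?thesis unfolding x(1) us by simp
  qed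
  have dis: "x \<notin> set (xs @ p # us')" "y \<noteq> p" "p \<notin> set us'" using d unfolding word by auto
  then have y: "y < p" "\<forall>z\<in>set us'. z < p" using x(3) us by (auto simp: not_less order.strict_iff_order)
  let ?X = "set (xs @ p # us')"
  have "ys = us' @ y # butlast (x # vs)"
    using x(1) us by (metis append.assoc append_Cons append_Nil butlast_append butlast_snoc list.distinct(1))
  then have "con y N ?X" using noncut by blast
  \<comment> \<open>Here \<open>e < p < x < f\<close>, with \<open>p\<close> on the left and
    \<open>x\<close> not on the left, so the left set is neither empty nor full.\<close>
  then obtain e f where ef: "y \<le> e" "f \<le> N" "con e f ?X" "?X \<inter> {e<..<f} = {} \<or> {e<..<f} \<subseteq> ?X"
    using simple by blast
  have nyx: "\<not> con y x ?X"
    using cmaxD[of "xs @ p # us'" y x "vs @ zs"] c unfolding word by blast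
  have "x < f" using con_mono[OF ef(3,1), of x] nyx by (meson not_less)
  moreover have "e < p"
  proof (rule ccontr)
    assume "\<not> e < p"
    then have "con p N ?X" using con_mono[OF ef(3) _ ef(2), of p] by simp
    moreover have "?X \<inter> {p<..<N} = set xs \<inter> {p<..<N}" using y(2) by auto
    ultimately show False using con_cong p by blast
  qed
  ultimately have "p \<in> ?X \<inter> {e<..<f}" "x \<in> {e<..<f}" using x(2) by auto
  then show False using ef(4) dis(1) by auto
qed

lemma steps_des_eq:
  assumes simple: "\<And>a b X. con a b X \<Longrightarrow>
      \<exists>c d. a \<le> c \<and> d \<le> b \<and> con c d X \<and> (X \<inter> {c<..<d} = {} \<or> {c<..<d} \<subseteq> X)"
  shows "step\<^sup>*\<^sup>* u v \<Longrightarrow> cmin u \<Longrightarrow> cmax v \<Longrightarrow> distinct u \<Longrightarrow> set u = {1..n} \<Longrightarrow> des u = des v"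
proof (induction n arbitrary: u v)
  case 0
  then show ?case using steps_set[of u v] by simp
next
  case (Suc m)
  define N where "N = Suc m"
  note st = Suc.prems(1) and du = Suc.prems(4)
  have v: "set v = {1..N}" "distinct v" using steps_set[OF st] Suc.prems unfolding N_def by auto
  have u: "set u = {1..N}" using Suc.prems unfolding N_def by simp
  have NI: "N \<in> {1..N}" unfolding N_def by simp
  obtain u1 u2 where U: "u = u1 @ N # u2" using split_list[of N u] u NI by auto
  obtain v1 v2 where V: "v = v1 @ N # v2" using split_list[of N v] v NI by auto
  have d: "distinct (u1 @ N # u2)" "distinct (v1 @ N # v2)" using du v U V by auto
  have le: "\<forall>x\<in>set (u1 @ N # u2). x \<le> N" "\<forall>x\<in>set (v1 @ N # v2). x \<le> N"
    using u v unfolding U V by auto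
  have lt: "\<forall>x\<in>set (u1 @ u2). x < N" "\<forall>x\<in>set (v1 @ v2). x < N"
    using le d by (auto simp: order.strict_iff_order)
  have rest: "set (u1 @ u2) = {1..m}"
  proof -
    have "set (u1 @ u2) = set u - {N}" using d unfolding U by auto
    also have "\<dots> = {1..m}" unfolding u N_def by auto
    finally show ?thesis .
  qed
  have cu: "cmin (u1 @ N # u2)" and cv: "cmax (v1 @ N # v2)" using Suc.prems(2,3) unfolding U V by blast+
  have IH: "des (u1 @ u2) = des (v1 @ v2)"
  proof (rule Suc.IH)
    show "step\<^sup>*\<^sup>* (u1 @ u2) (v1 @ v2)" 
      using steps_remove_at[OF st[unfolded U V] d(1)] le(1) by blast
    show "cmin (u1 @ u2)" using cmin_remove_max[OF cu le(1)] .
    show "cmax (v1 @ v2)" using cmax_remove_max[OF cv le(2)] .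
    show "distinct (u1 @ u2)" using d by auto
  qed (rule rest)
  let ?Pu = "u2 \<noteq> [] \<and> (u1 \<noteq> [] \<longrightarrow> last u1 < hd u2 \<or> last u1 = hd u2)"
  let ?Pv = "v2 \<noteq> [] \<and> (v1 \<noteq> [] \<longrightarrow> last v1 < hd v2 \<or> last v1 = hd v2)"
  show ?case
  proof (cases "m = 0")
    case True
    then have "u1 = []" "u2 = []" using rest by auto
    then have "set v = {N}" using steps_set[OF st] U by simp
    then have "v1 = []" "v2 = []" using d(2) unfolding V by (cases v1; cases v2; auto)+
    then show ?thesis using U V \<open>u1 = []\<close> \<open>u2 = []\<close> by simp
  next
    case False
    let ?C = "con_to N"
    define \<alpha> where "\<alpha> = cuts ?C {} u1"
    define \<beta> where "\<beta> = cuts ?C (insert N (set u1)) u2"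
    have "cuts ?C {} (v1 @ N # v2) = cuts ?C {} (u1 @ N # u2)"
      using cuts_steps[OF st[unfolded U V] le(1)] .
    then have ab: "cuts ?C {} v1 = \<alpha>" "cuts ?C (insert N (set v1)) v2 = \<beta>"
      using cuts_split[of ?C v1 N v2 u1 u2, OF _ _ d] con_less unfolding \<alpha>_def \<beta>_def by blast+
    have "m \<in> set (u1 @ u2)" unfolding rest using False by simp
    then have ne: "\<alpha> \<noteq> [] \<or> \<beta> \<noteq> []"
      using pred_in_cuts[of m u1 u2] unfolding \<alpha>_def \<beta>_def N_def by blast
    have v1: "v1 \<noteq> [] \<Longrightarrow> \<alpha> \<noteq> [] \<and> last \<alpha> = last v1 \<and> \<not> con (last v1) N (set (butlast v1))"
      using cut_before_max[OF cv] ab by simp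
    have u2: "\<beta> \<noteq> [] \<and> hd \<beta> = hd u2 \<and> \<not> con (hd u2) N (set u1)" if "u2 \<noteq> []"
    proof -
      have "\<not> con (hd u2) N (set u1)" using cut_after_min[OF cu that] .
      moreover from this have "\<not> con (hd u2) N (insert N (set u1))" using con_insert_max by simp
      ultimately show ?thesis unfolding \<beta>_def using that by (cases u2) auto
    qed
    have blast_set: "set w = insert (last w) (set (butlast w))" if "w \<noteq> []" for w :: "nat list"
      using that by (metis append_butlast_last_id list.simps(15) rotate1.simps(2) set_rotate1)
    \<comment> \<open>\<open>N\<close> must add a descent in both words or in neither. If there is
      no cut on the right, it adds none; if there is none on the left, it adds one. Otherwise it
      stands between cuts \<open>p\<close> and \<open>q\<close>, and half of the work is automatic:
      in \<open>v\<close> the letter after \<open>p\<close> is smaller if \<open>p > q\<close>, and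
      in \<open>u\<close> the letter before \<open>q\<close> is smaller if \<open>p < q\<close>. The
      adjacency lemmas settle the other word.\<close>
    have "?Pu \<longleftrightarrow> ?Pv"
    proof (cases "\<alpha> = [] \<or> \<beta> = []")
      case True
      show ?thesis
      proof (cases "\<beta> = []")
        case True
        then have "u2 = []" using u2 by blast
        moreover have "des (v1 @ N # v2) = des (v1 @ v2)"
          using des_remove_max_cuts_Nil[OF cv d(2) lt(2)] ab True ne by simp
        then have "\<not> ?Pv" using des_remove_max[OF lt(2)] by (auto split: if_splits)
        ultimately show ?thesis by blast
      next
        case False
        with \<open>\<alpha> = [] \<or> \<beta> = []\<close> have a: "\<alpha> = []" by blast
        then have "v1 = []" using v1 by blast
        moreover have ne2: "v2 \<noteq> []" "u2 \<noteq> []" using False ab(2) unfolding \<beta>_def by auto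
        moreover have "last u1 \<le> hd u2" if "u1 \<noteq> []"
        proof -
          have "u1 = butlast u1 @ last u1 # []" using that by simp
          then have "con (last u1) N (set (butlast u1))"
            using cuts_NilD[of ?C "{}" "butlast u1" "last u1" "[]"] a unfolding \<alpha>_def by simp
          then show ?thesis using con_prev_less u2[OF ne2(2)] blast_set[OF that] by simp
        qed
        ultimately show ?thesis by (auto simp: le_less)
      qed
    next
      case False
      then have ne: "\<alpha> \<noteq> []" "\<beta> \<noteq> []" by auto
      define p where "p = last \<alpha>"
      define q where "q = hd \<beta>"
      have nn: "u1 \<noteq> []" "v1 \<noteq> []" "u2 \<noteq> []" "v2 \<noteq> []"
        using ne ab unfolding \<alpha>_def \<beta>_def by auto
      have p: "last v1 = p" "\<not> con p N (set (butlast v1))" using v1[OF nn(2)] unfolding p_def by auto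
      have q: "hd u2 = q" "\<not> con q N (set u1)" using u2[OF nn(3)] unfolding q_def by auto
      obtain u3 u4 where u34: "u1 = u3 @ p # u4" "cuts ?C (set (u3 @ [p])) u4 = []"
        using cuts_last[of ?C "{}" u1] ne(1) unfolding \<alpha>_def p_def by auto
      obtain v3 v4 where v34: "v2 = v3 @ q # v4" "cuts ?C (insert N (set v1)) v3 = []"
        using cuts_first[of ?C "insert N (set v1)" v2] ne(2) ab(2) unfolding q_def by auto
      obtain u5 where u5: "u2 = q # u5" using q(1) nn(3) by (cases u2) auto
      obtain v0 where v0: "v1 = v0 @ [p]" using p(1) nn(2) by (metis append_butlast_last_id)
      have p': "\<not> con p N (set v0)" using p(2) v0 by simp
      have "cuts ?C (insert N (set v1)) w = cuts ?C (set v1) w" if "N \<notin> set w" for w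
      proof -
        have "cuts ?C (insert N X) w = cuts ?C X w" for X
          using that con_insert_max by (induction w arbitrary: X) (auto simp: insert_commute[of _ N])
        then show ?thesis .
      qed
      then have v3: "cuts ?C (set (v0 @ [p])) v3 = []" using v34 d(2) v0 by auto
      have pq: "p \<noteq> q" using d(1) u34(1) u5 by auto
      have v3_less: "hd v3 < p" if "v3 \<noteq> []"
      proof -
        have "v3 = [] @ hd v3 # tl v3" using that by simp
        then have "con (hd v3) N (insert p (set v0))"
          using cuts_NilD[of ?C "set (v0 @ [p])" "[]" "hd v3" "tl v3"] v3 by simp
        then have "hd v3 \<le> p" using con_next_less[OF p'] by blast
        moreover have "hd v3 \<noteq> p" using d(2) v0 v34(1) that by (cases v3) auto
        ultimately show ?thesis by simp
      qed
      have u4_less: "last u4 \<le> q" if "u4 \<noteq> []"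
      proof -
        have "u4 = butlast u4 @ last u4 # []" using that by simp
        then have "con (last u4) N (set (u3 @ [p]) \<union> set (butlast u4))"
          using cuts_NilD[of ?C "set (u3 @ [p])" "butlast u4" "last u4" "[]"] u34(2) by simp
        moreover have "set u1 = insert (last u4) (set (u3 @ [p]) \<union> set (butlast u4))"
          unfolding u34(1) using blast_set[OF that] by auto
        ultimately show ?thesis using con_prev_less q(2) by simp
      qed
      show ?thesis
      proof (cases "p > q")
        case True
        have "u4 = []"
          using adjacent_cuts_cmin[OF simple, of u3 p u4 q u5 N] cmin_remove_max[OF cu le(1)] d(1) q(2) u34 u5 True
          by simp
        then have "\<not> ?Pu" using True u34(1) u5 by simp
        moreover have "\<not> ?Pv"
          using True v0 v34(1) v3_less by (cases v3) auto
        ultimately show ?thesis by blast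
      next
        case False
        then have less: "p < q" using pq by simp
        have "v3 = []"
          using adjacent_cuts_cmax[OF simple, of v0 p v3 q v4 N] cmax_remove_max[OF cv le(2)] d(2) p' v3 v34(1) v0 less
          by simp
        then have ?Pv using less v0 v34(1) by simp
        moreover have ?Pu
          using less u34(1) u5 u4_less by (cases "u4 = []") auto
        ultimately show ?thesis by blast
      qed
    qed
    then show ?thesis using des_remove_max[OF lt(1)] des_remove_max[OF lt(2)] IH U V by simp
  qed
qed

section \<open>Stripping the values outside an interval\<close>

text \<open>Cuts are now the values that the smallest value \<open>m\<close> cannot cross. In
  \<open>v\<close> only non-cuts precede \<open>m\<close>, and the letter after it is a cut, hence
  smaller than the letter before it, if there is one. So \<open>m\<close> sits in a descent or at
  the front, and its deletion changes no count.\<close>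

lemma des_cons_min:
  assumes st: "step\<^sup>*\<^sup>* (m # w) v" and c: "cmax v" and d: "distinct (m # w)"
    and N: "\<forall>x\<in>set w. m < x" and m: "Suc m \<in> set w"
  shows "\<exists>v'. step\<^sup>*\<^sup>* w v' \<and> cmax v' \<and> des v' = des v"
proof -
  have sv: "set v = set (m # w)" "distinct v" using steps_set[OF st] d by auto
  then obtain v1 v2 where v: "v = v1 @ m # v2" using split_list[of m v] by auto
  have ge: "\<forall>x\<in>set (m # w). m \<le> x" using N by auto
  then have gev: "\<forall>x\<in>set (v1 @ m # v2). m \<le> x" unfolding sv(1)[symmetric] v .
  have gt: "\<forall>x\<in>set (v1 @ v2). m < x"
  proof
    fix x assume x: "x \<in> set (v1 @ v2)"
    then have "x \<noteq> m" "m \<le> x" using gev sv(2) v by auto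
    then show "m < x" by simp
  qed
  let ?C = "con m"
  \<comment> \<open>Mirror image of \<open>cuts_step\<close>: the larger letter \<open>b\<close> is
    a non-cut throughout, and the status of \<open>a\<close> ignores \<open>b\<close>.\<close>
  have inv: "cuts ?C {} z = cuts ?C {} y" if s: "step y z" and y: "\<forall>x\<in>set y. m \<le> x" for y z
  proof -
    from s obtain xs a b ys where e: "y = xs @ a # b # ys" "z = xs @ b # a # ys" and c: "con a b (set xs)"
      unfolding step_def by blast
    have ab: "a < b" using c by (rule con_less)
    have ma: "m \<le> a" using y e by simp
    have "con a b (insert a (set xs))" using c con_insert_left[of a a b] by simp
    then have "con m b (set xs)" "con m b (insert a (set xs))"
      using con_mono[OF _ ma order_refl] c by blast+
    moreover have "con m a (insert b (set xs)) = con m a (set xs)"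
      using con_insert_left[of b m a] ab by simp
    ultimately have "cuts ?C (set xs) [a, b] = cuts ?C (set xs) [b, a]" by simp
    moreover from this have "cuts ?C (set xs) ([a, b] @ ys) = cuts ?C (set xs) ([b, a] @ ys)"
      unfolding cuts_append by (simp add: insert_commute)
    ultimately show ?thesis using e by (simp add: cuts_append)
  qed
  have "cuts ?C {} v = cuts ?C {} (m # w)"
    using st
  proof (induction rule: rtranclp_induct)
    case (step y z)
    have "\<forall>x\<in>set y. m \<le> x" using ge steps_set[OF step(1)] by simp
    then show ?case using inv step by simp
  qed simp
  then have e: "cuts ?C {} v1 = []" "cuts ?C (insert m (set v1)) v2 = cuts ?C {m} w"
    using cuts_split[of ?C v1 m v2 "[]" w] con_less d sv(2) v by auto
  \<comment> \<open>This cut keeps \<open>m\<close> from being the last letter of \<open>v\<close>,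
    where its deletion could lose a descent.\<close>
  have "Suc m \<in> set (cuts ?C X w)" for X
    using m con_Suc by (induction w arbitrary: X) auto
  then have "Suc m \<in> set (cuts ?C {m} w)" .
  then have "v2 \<noteq> []" using e(2) by auto
  then obtain q qs where q: "v2 = q # qs" by (cases v2) auto
  have "des v = des (v1 @ v2)"
  proof (cases v1 rule: rev_cases)
    case Nil
    then show ?thesis using v q gt by simp
  next
    case (snoc xs p)
    have "con m p (set xs)" using e(1) cuts_NilD[of ?C "{}" xs p "[]"] snoc by simp
    then have mp: "con m p (insert p (set xs))" using con_insert_left[of p m p] by simp
    have "\<not> con m q (insert p (set xs))" using cmaxD[of v1 m q qs] c v q snoc by simp
    then have "\<not> p \<le> q" using con_mono[OF mp order_refl] by blast
    moreover have "m < p" "m < q" using gt snoc q by auto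
    ultimately show ?thesis
      using des_append[of xs p m "q # qs"] des_append[of xs p q qs] v q snoc by simp
  qed
  moreover have "step\<^sup>*\<^sup>* w (v1 @ v2)"
    using steps_remove_at[of "[]" m w v1 v2] st d ge v by simp
  moreover have "cmax (v1 @ v2)"
    using cmax_remove_min[OF _ gev] c v by simp
  ultimately show ?thesis by auto
qed

lemma strip_max:
  assumes "\<forall>x\<in>set w. x \<le> b" "b \<in> set w" "distinct w"
    and "step\<^sup>*\<^sup>* (w @ [Suc b..<Suc b + k]) v" "cmax v"
  shows "\<exists>v'. step\<^sup>*\<^sup>* w v' \<and> cmax v' \<and> des v' = des v"
  using assms(4,5)
proof (induction k arbitrary: v)
  case (Suc k)
  let ?u = "w @ [Suc b..<Suc b + k]"
  have e: "w @ [Suc b..<Suc b + Suc k] = ?u @ [Suc (b + k)]" by simp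
  have "\<exists>v'. step\<^sup>*\<^sup>* ?u v' \<and> cmax v' \<and> des v' = des v"
  proof (rule des_snoc_max)
    show "step\<^sup>*\<^sup>* (?u @ [Suc (b + k)]) v" "cmax v" using Suc.prems e by simp_all
    show "distinct (?u @ [Suc (b + k)])" using assms(1,3) by fastforce
    show "\<forall>x\<in>set ?u. x < Suc (b + k)" using assms(1) by fastforce
    show "b + k \<in> set ?u" using assms(2) by (cases k) auto
  qed
  then show ?case using Suc.IH by fastforce
qed auto

lemma strip_min:
  assumes "\<forall>x\<in>set w. a \<le> x" "a \<in> set w" "distinct w"
    and "step\<^sup>*\<^sup>* ([a - k..<a] @ w) v" "cmax v"
  shows "\<exists>v'. step\<^sup>*\<^sup>* w v' \<and> cmax v' \<and> des v' = des v"
  using assms(4,5)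
proof (induction k arbitrary: v)
  case (Suc k)
  show ?case
  proof (cases "k < a")
    case True
    let ?u = "[a - k..<a] @ w" and ?m = "a - Suc k"
    have Sm: "Suc ?m = a - k" "?m < a" using True by auto
    then have e: "[a - Suc k..<a] @ w = ?m # ?u" using upt_conv_Cons[of ?m a] by simp
    have "\<exists>v'. step\<^sup>*\<^sup>* ?u v' \<and> cmax v' \<and> des v' = des v"
    proof (rule des_cons_min)
      show "step\<^sup>*\<^sup>* (?m # ?u) v" "cmax v" using Suc.prems e by simp_all
      show "distinct (?m # ?u)" using assms(1,3) Sm by fastforce
      show "\<forall>x\<in>set ?u. ?m < x" using assms(1) Sm by fastforce
      show "Suc ?m \<in> set ?u" unfolding Sm(1) using assms(2) True by (cases k) auto
    qed
    then show ?thesis using Suc.IH by fastforce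
  next
    case False
    \<comment> \<open>Truncated subtraction: once \<open>k \<ge> a\<close> the prefix stops
      growing.\<close>
    then have "a - Suc k = a - k" by simp
    then show ?thesis using Suc by simp
  qed
qed auto

text \<open>\<open>F1\<close> and \<open>F2\<close> make the fence at every adjacent pair within \<open>[a,b]\<close> a restriction of \<open>(a,b,L)\<close>, so
  maximality of that fence excludes contraction.\<close>

lemma con_adjacent:
  assumes d: "distinct w" and ab: "{a..b} \<subseteq> set w"
    and F1: "\<And>x y. x \<in> L \<Longrightarrow> bef w y x \<Longrightarrow> y < x"
    and F2: "\<And>x y. x \<in> {a<..<b} - L \<Longrightarrow> bef w x y \<Longrightarrow> x < y"
    and w: "w = xs @ p # q # ys" and r: "a \<le> min p q" "max p q \<le> b"
    and c: "con (min p q) (max p q) (set xs)"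
  shows "con (min p q) (max p q) L"
proof -
  have "set xs \<inter> {min p q<..<max p q} = L \<inter> {min p q<..<max p q}"
  proof (intro equalityI subsetI)
    fix x assume x: "x \<in> set xs \<inter> {min p q<..<max p q}"
    then have "bef w x p" "bef w x q" using w by auto
    then have "x \<notin> {a<..<b} - L" using F2[of x p] F2[of x q] x r by (auto simp: min_def max_def split: if_splits)
    then show "x \<in> L \<inter> {min p q<..<max p q}" using x r by auto
  next
    fix x assume x: "x \<in> L \<inter> {min p q<..<max p q}"
    then have "min p q < x" "x < max p q" unfolding Int_iff greaterThanLessThan_iff by blast+
    then have "a \<le> x" "x \<le> b" using r by linarith+
    then have "x \<in> set w" using ab by auto
    moreover have "x \<noteq> p" "x \<noteq> q" using x by auto
    moreover have "x \<notin> set ys"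
    proof
      assume "x \<in> set ys"
      then have "bef w p x" "bef w q x" using w by auto
      then have "p < x" "q < x" using F1[of x] x r by auto
      then show False using x by auto
    qed
    ultimately show "x \<in> set xs \<inter> {min p q<..<max p q}" using x w by auto
  qed
  then show ?thesis using c con_cong by blast
qed

end

lemma des_sorted: "sorted w \<Longrightarrow> des w = 0"
  by (induction w rule: des.induct) auto

lemma des_sorted_blocks:
  assumes "sorted (A @ [p])" "sorted (y # B)" "a < p" "p < b" "a < y" "y < b"
  shows "des ((A @ [p]) @ [a, b] @ y # B) = 2" "des ((A @ [p]) @ [b, a] @ y # B) = 1"
  using assms des_append[of A p a "b # y # B"] des_append[of A p b "a # y # B"]
    des_sorted[of "y # B"] des_sorted[of "A @ [p]"]
  by simp_all

section \<open>Degrees in the quotient graph\<close>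

context
  fixes n :: nat and R :: "(nat list \<times> nat list) set"
  assumes R: "lattice_congruence n R"
begin

definition join_of :: "nat list \<Rightarrow> nat list \<Rightarrow> nat list" where
  "join_of x y = (SOME t. is_join n x y t)"

definition meet_of :: "nat list \<Rightarrow> nat list \<Rightarrow> nat list" where
  "meet_of x y = (SOME t. is_meet n x y t)"

lemma is_join_of: "x \<in> perms n \<Longrightarrow> y \<in> perms n \<Longrightarrow> is_join n x y (join_of x y)"
  unfolding join_of_def by (rule someI_ex) (rule exists_join)

lemma is_meet_of: "x \<in> perms n \<Longrightarrow> y \<in> perms n \<Longrightarrow> is_meet n x y (meet_of x y)"
  unfolding meet_of_def by (rule someI_ex) (rule exists_meet)

lemma up_neq: "up w z \<Longrightarrow> w \<noteq> z"
  by (auto simp: up_def)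

lemma up_between:
  assumes "x \<in> perms n" "z \<in> perms n" "up x y" "weak_le x z" "weak_le z y"
  shows "z = x \<or> z = y"
proof -
  obtain p where p: "inversions y = insert p (inversions x)" using up_inversions assms by blast
  have "y \<in> perms n" using assms up_perms by blast
  moreover have "inversions z = inversions x \<or> inversions z = inversions y"
    using assms(4,5) unfolding weak_le_def p by auto
  ultimately show ?thesis using weak_le_antisym assms(1,2) unfolding weak_le_def by auto
qed

lemma weak_order_congruence:
  "finite_lattice_congruence (perms n) weak_le up join_of meet_of R"
proof
  show "finite (perms n)" by (rule finite_perms)
  show "equiv (perms n) R" using R by (rule cong_equiv)
  fix x y z
  show "weak_le x x" by (simp add: weak_le_def)
  show "weak_le x y \<Longrightarrow> weak_le y z \<Longrightarrow> weak_le x z" by (simp add: weak_le_def)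
  show "x \<in> perms n \<Longrightarrow> y \<in> perms n \<Longrightarrow> weak_le x y \<Longrightarrow> weak_le y x \<Longrightarrow> x = y" by (rule weak_le_antisym)
  {
    assume p: "x \<in> perms n" "y \<in> perms n"
    note j = is_join_of[OF p, unfolded is_join_def] and m = is_meet_of[OF p, unfolded is_meet_def]
    show "join_of x y \<in> perms n" "weak_le x (join_of x y)" "weak_le y (join_of x y)"
      "z \<in> perms n \<Longrightarrow> weak_le x z \<Longrightarrow> weak_le y z \<Longrightarrow> weak_le (join_of x y) z"
      using j by blast+
    show "meet_of x y \<in> perms n" "weak_le (meet_of x y) x" "weak_le (meet_of x y) y"
      "z \<in> perms n \<Longrightarrow> weak_le z x \<Longrightarrow> weak_le z y \<Longrightarrow> weak_le z (meet_of x y)"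
      using m by blast+
    show "weak_le x y \<Longrightarrow> x \<noteq> y \<Longrightarrow> \<exists>z. up x z \<and> weak_le z y" using exists_up_below[OF p] .
  }
  show "x \<in> perms n \<Longrightarrow> up x y \<Longrightarrow> y \<in> perms n" using up_perms by blast
  show "up x y \<Longrightarrow> weak_le x y" by (rule up_weak_le)
  show "up x y \<Longrightarrow> x \<noteq> y" by (rule up_neq)
  show "x \<in> perms n \<Longrightarrow> z \<in> perms n \<Longrightarrow> up x y \<Longrightarrow> weak_le x z \<Longrightarrow> weak_le z y \<Longrightarrow> z = x \<or> z = y"
    by (rule up_between)
  assume xy: "(x, y) \<in> R" and z: "z \<in> perms n"
  have p: "x \<in> perms n" "y \<in> perms n" using cong_perms[OF R xy] by blast+
  show "(join_of x z, join_of y z) \<in> R" using cong_join[OF R xy z is_join_of is_join_of] p z by blast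
  show "(meet_of x z, meet_of y z) \<in> R" using cong_meet[OF R xy z is_meet_of is_meet_of] p z by blast
qed

interpretation W: finite_lattice_congruence "perms n" weak_le up join_of meet_of R
  by (rule weak_order_congruence)

text \<open>In the instance \<open>D\<close> below, \<open>D.greatest_in X u\<close> says that
  \<open>u\<close> is the least element of \<open>X\<close>, and \<open>D.cls_covers X Y\<close>
  that \<open>X\<close> covers \<open>Y\<close> in the quotient.\<close>

lemma dual_weak_order_congruence:
  "finite_lattice_congruence (perms n) (\<lambda>x y. weak_le y x) (\<lambda>x y. up y x) meet_of join_of R"
proof
  fix x y z
  show "x \<in> perms n \<Longrightarrow> z \<in> perms n \<Longrightarrow> up y x \<Longrightarrow> weak_le z x \<Longrightarrow> weak_le y z \<Longrightarrow> z = x \<or> z = y"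
    using up_between[of y z x] up_perms by blast
  show "x \<in> perms n \<Longrightarrow> up y x \<Longrightarrow> y \<in> perms n" using up_perms by blast
  show "x \<in> perms n \<Longrightarrow> y \<in> perms n \<Longrightarrow> weak_le y x \<Longrightarrow> x \<noteq> y \<Longrightarrow> \<exists>z. up z x \<and> weak_le y z"
    using exists_up_above[of y n x] by blast
  show "up y x \<Longrightarrow> x \<noteq> y" using up_neq by blast
qed (fact W.finite_P W.le_refl W.le_trans[rotated] W.le_antisym[rotated 2] W.meet_in W.meet_le1 W.meet_le2
  W.meet_greatest W.join_in W.join_ge1 W.join_ge2 W.join_least W.covers_le W.equiv_R W.join_R W.meet_R
  | use W.le_antisym in blast)+

interpretation D: finite_lattice_congruence "perms n" "\<lambda>x y. weak_le y x" "\<lambda>x y. up y x" meet_of join_of R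
  by (rule dual_weak_order_congruence)

lemma quot_cover_iff: "quot_cover n R X Y \<longleftrightarrow> W.cls_covers X Y" "quot_cover n R X Y \<longleftrightarrow> D.cls_covers Y X"
  unfolding quot_cover_def W.cls_covers_def D.cls_covers_def quot_le_def W.cls_le_def D.cls_le_def
  by blast+

lemma card_neighbours:
  assumes X: "X \<in> perms n // R" and v: "W.greatest_in X v" and u: "D.greatest_in X u"
  shows "card (Q_neighbors n R X) + des v = n - 1 + des u"
proof -
  have "Q_neighbors n R X = {Y. W.cls_covers X Y} \<union> {Y. D.cls_covers X Y}"
    unfolding Q_neighbors_def using quot_cover_iff by blast
  moreover have "{Y. W.cls_covers X Y} \<inter> {Y. D.cls_covers X Y} = {}"
    using quot_cover_iff W.not_cls_covers_both by blast
  ultimately have "card (Q_neighbors n R X) = card {z. up v z} + card {z. up z u}"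
    using W.card_upper_neighbours[OF X v] D.card_upper_neighbours[OF X u]
      W.finite_upper_neighbours D.finite_upper_neighbours by (simp add: card_Un_disjoint)
  moreover have "distinct v" "distinct u" "length v = n"
  proof -
    have "v \<in> perms n" "u \<in> perms n"
      using u v W.cls_P[OF X] by (auto simp: W.greatest_in_def D.greatest_in_def)
    then show "distinct v" "distinct u" "length v = n"
      using distinct_card[of v] by (auto simp: perms_def)
  qed
  ultimately show ?thesis using card_up_down[of v] card_up_down[of u] by auto
qed

abbreviation con :: "nat \<Rightarrow> nat \<Rightarrow> nat set \<Rightarrow> bool" where
  "con \<equiv> contracts n R"

lemma contracts_less: "con a b X \<Longrightarrow> a < b"
  by (auto simp: contracts_def contracted_fences_def is_fence_def)

lemma contracts_mono: "con c d X \<Longrightarrow> a \<le> c \<Longrightarrow> d \<le> b \<Longrightarrow> con a b X"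
  unfolding contracts_def by (meson order_trans)

lemma contracts_cong:
  assumes "con a b X" "X \<inter> {a<..<b} = Y \<inter> {a<..<b}"
  shows "con a b Y"
proof -
  obtain c d where cd: "a \<le> c" "d \<le> b" "(c, d, X \<inter> {c<..<d}) \<in> contracted_fences n R"
    using assms(1) by (auto simp: contracts_def)
  have "{c<..<d} = {a<..<b} \<inter> {c<..<d}" using cd by auto
  then have "X \<inter> {c<..<d} = Y \<inter> {c<..<d}" using assms(2) by (metis inf_assoc)
  then show ?thesis using cd unfolding contracts_def by metis
qed

context
  assumes ess: "essential n R"
begin

lemma contracts_Suc: "\<not> con k (Suc k) X"
proof
  assume c: "con k (Suc k) X"
  then obtain c d where cd: "k \<le> c" "d \<le> Suc k" "(c, d, X \<inter> {c<..<d}) \<in> contracted_fences n R"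
    by (auto simp: contracts_def)
  moreover have "c < d" using cd(3) by (auto simp: contracted_fences_def is_fence_def)
  ultimately have "c = k" "d = Suc k" by auto
  moreover have "{k<..<Suc k} = {}" by auto
  ultimately have "(k, Suc k, {}) \<in> contracted_fences n R" using cd(3) by simp
  then show False using ess by (simp add: essential_def)
qed

interpretation contraction con
  by unfold_locales (fact contracts_less contracts_mono contracts_cong contracts_Suc)+

lemma greatest_cmax:
  assumes X: "X \<in> perms n // R" and v: "W.greatest_in X v"
  shows "cmax v"
  unfolding cmax_def
proof (intro allI impI notI)
  fix xs a b ys assume e: "v = xs @ a # b # ys" and c: "con a b (set xs)"
  have ab: "a < b" using c by (rule contracts_less)
  have vX: "v \<in> X" "v \<in> perms n" using v W.cls_P[OF X] by (auto simp: W.greatest_in_def)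
  then have "(v, xs @ b # a # ys) \<in> R" using contracts_edge_iff[OF R _ ab] c e by blast
  then have "weak_le (xs @ b # a # ys) v" using W.cls_R[OF X] vX v by (auto simp: W.greatest_in_def)
  moreover have "up v (xs @ b # a # ys)" using upI[OF ab] e by blast
  ultimately show False
    using up_weak_le up_neq up_perms weak_le_antisym vX(2) by metis
qed

lemma least_cmin:
  assumes X: "X \<in> perms n // R" and u: "D.greatest_in X u"
  shows "cmin u"
  unfolding cmin_def
proof (intro allI impI notI)
  fix xs a b ys assume e: "u = xs @ b # a # ys" and c: "con a b (set xs)"
  let ?z = "xs @ a # b # ys"
  have ab: "a < b" using c by (rule contracts_less)
  have uX: "u \<in> X" "u \<in> perms n" using u W.cls_P[OF X] by (auto simp: D.greatest_in_def)
  have z: "?z \<in> perms n" using uX(2) e perms_swap by blast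
  then have "(?z, u) \<in> R" using contracts_edge_iff[OF R z ab] c e by blast
  then have "weak_le u ?z" using W.R_sym W.cls_R[OF X] uX u by (auto simp: D.greatest_in_def)
  moreover have "up ?z u" using upI[OF ab] e by blast
  ultimately show False
    using up_weak_le up_neq z weak_le_antisym uX(2) by metis
qed

text \<open>A chain of covers inside the interval \<open>[u, w]\<close> stays in the class by
  convexity, so all its edges are contracted.\<close>

lemma steps_in_class:
  assumes X: "X \<in> perms n // R" and uw: "u \<in> X" "w \<in> X" "weak_le u w"
  shows "step\<^sup>*\<^sup>* u w"
proof -
  have p: "u \<in> perms n" "w \<in> perms n" "(u, w) \<in> R" using uw W.cls_P[OF X] W.cls_R[OF X] by blast+
  have "step y z" if "up y z \<and> y \<in> perms n \<and> weak_le u y \<and> weak_le z w" for y z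
  proof -
    have yz: "up y z" "y \<in> perms n" "weak_le u y" "weak_le z w" using that by blast+
    then have "weak_le y z" "z \<in> perms n" using up_weak_le up_perms by blast+
    then have "weak_le y w" "weak_le u z" using yz unfolding weak_le_def by blast+
    then have "(u, y) \<in> R" "(u, z) \<in> R"
      using cong_convex(1)[OF R p(3)] yz \<open>z \<in> perms n\<close> by blast+
    then have yzR: "(y, z) \<in> R" using W.R_sym W.R_trans by blast
    obtain xs a b ys where e: "y = xs @ a # b # ys" "z = xs @ b # a # ys" "a < b"
      using yz(1) by (auto simp: up_def)
    then have "con a b (set xs)" using contracts_edge_iff[OF R] yzR yz(2) by blast
    then show ?thesis using e unfolding step_def by blast
  qed
  then show ?thesis using up_rtranclp[OF p(1,2) uw(3)]
    by (elim rtranclp_mono[THEN predicate2D, rotated]) blast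
qed

text \<open>Otherwise the last step of a chain from \<open>u\<close> to \<open>w\<close> would be a
  contracted edge leading down from \<open>w\<close>.\<close>

lemma cmin_least:
  assumes X: "X \<in> perms n // R" and u: "D.greatest_in X u" and w: "w \<in> X" "cmin w"
  shows "w = u"
proof -
  have "step\<^sup>*\<^sup>* u w" using steps_in_class[OF X _ w(1)] u w(1) by (auto simp: D.greatest_in_def)
  then show ?thesis using w(2) by (cases rule: rtranclp.cases) (auto simp: step_def cmin_def)
qed

text \<open>Among the contracted fences that restrict \<open>X\<close> to a subinterval of
  \<open>[a, b]\<close>, one of least length is maximal in the forcing order, since anything forcing
  it restricts \<open>X\<close> to a shorter interval.\<close>

lemma simple_contracts:
  assumes simple: "\<forall>f\<in>reduced_arc_diagram n R. simple_fence f" and c: "con a b X"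
  shows "\<exists>c d. a \<le> c \<and> d \<le> b \<and> con c d X \<and> (X \<inter> {c<..<d} = {} \<or> {c<..<d} \<subseteq> X)"
proof -
  let ?P = "\<lambda>(c, d). a \<le> c \<and> d \<le> b \<and> (c, d, X \<inter> {c<..<d}) \<in> contracted_fences n R"
  obtain c0 d0 where "?P (c0, d0)" using c by (auto simp: contracts_def)
  then obtain cd where cd: "?P cd" "\<And>ef. ?P ef \<Longrightarrow> snd cd - fst cd \<le> snd ef - fst ef"
    using ex_has_least_nat[of ?P "(c0, d0)" "\<lambda>p. snd p - fst p"] by auto
  obtain c d where [simp]: "cd = (c, d)" by (cases cd)
  let ?f = "(c, d, X \<inter> {c<..<d})"
  have f: "a \<le> c" "d \<le> b" "?f \<in> contracted_fences n R" using cd(1) by auto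
  have "\<not> forces_lt ?f g" if g: "g \<in> contracted_fences n R" for g
  proof
    assume lt: "forces_lt ?f g"
    obtain e h M where [simp]: "g = (e, h, M)" by (cases g)
    have eh: "c \<le> e" "e < h" "h \<le> d" "(c, d) \<noteq> (e, h)" "M = X \<inter> {c<..<d} \<inter> {e<..<h}"
      using lt by (auto simp: forces_lt_def)
    then have "M = X \<inter> {e<..<h}" by auto
    then have "d - c \<le> h - e" using cd(2)[of "(e, h)"] g f eh by auto
    then show False using eh by auto
  qed
  then have "?f \<in> reduced_arc_diagram n R" using f unfolding reduced_arc_diagram_def by blast
  then have "simple_fence ?f" using simple by blast
  then have "X \<inter> {c<..<d} = {} \<or> {c<..<d} \<subseteq> X" by (auto simp: simple_fence_def)
  moreover have "con c d X" using f(3) unfolding contracts_def by blast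
  ultimately show ?thesis using f by blast
qed

lemma simple_regular:
  assumes simple: "\<forall>f\<in>reduced_arc_diagram n R. simple_fence f"
  shows "Q_regular_of_degree n R (n - 1)"
  unfolding Q_regular_of_degree_def
proof
  fix X assume X: "X \<in> perms n // R"
  obtain v where v: "W.greatest_in X v" using W.greatest_exists[OF X] by blast
  obtain u where u: "D.greatest_in X u" using D.greatest_exists[OF X] by blast
  have uv: "u \<in> X" "v \<in> X" "weak_le u v" using u v by (auto simp: W.greatest_in_def D.greatest_in_def)
  have "u \<in> perms n" using W.cls_P[OF X] uv by blast
  then have "distinct u" "set u = {1..n}" by (auto simp: perms_def)
  then have "des u = des v"
    using steps_des_eq[OF simple_contracts[OF simple]] steps_in_class[OF X uv] least_cmin[OF X u] greatest_cmax[OF X v]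
    by blast
  then show "card (Q_neighbors n R X) = n - 1" using card_neighbours[OF X v u] by simp
qed

text \<open>Adjacent letters of the identity are consecutive, so by essentiality none of its edges
  is contracted and its class is a singleton. This fixes the degree of any regular quotient.\<close>

lemma card_neighbours_ident:
  "\<exists>X \<in> perms n // R. card (Q_neighbors n R X) = n - 1"
proof -
  let ?w = "[1..<Suc n]"
  define X where "X = R `` {?w}"
  have X: "X \<in> perms n // R" "?w \<in> X"
    unfolding X_def using ident_perms W.R_refl by (auto intro: quotientI simp del: upt_Suc)
  obtain v where v: "W.greatest_in X v" using W.greatest_exists[OF X(1)] by blast
  obtain u where u: "D.greatest_in X u" using D.greatest_exists[OF X(1)] by blast
  have adj: "b = Suc a" if e: "?w = xs @ a # b # ys" for xs a b ys
  proof -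
    have "length xs < n" "Suc (length xs) < n" using arg_cong[OF e, of length] by (simp_all del: upt_Suc)
    then have "?w ! length xs = Suc (length xs)" "?w ! Suc (length xs) = Suc (Suc (length xs))"
      by (simp_all del: upt_Suc)
    moreover have "?w ! length xs = a" "?w ! Suc (length xs) = b" unfolding e by (simp_all add: nth_append)
    ultimately show ?thesis by simp
  qed
  have "cmin ?w" unfolding cmin_def
  proof (intro allI impI notI)
    fix xs a b ys assume e: "?w = xs @ b # a # ys" and c: "con a b (set xs)"
    show False using adj[OF e] contracts_less[OF c] by simp
  qed
  then have eu: "?w = u" using cmin_least[OF X(1) u X(2)] by blast
  have ev: "?w = v"
  proof -
    have "step\<^sup>*\<^sup>* ?w v"
      using steps_in_class[OF X(1,2)] v X(2) unfolding W.greatest_in_def by blast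
    then show ?thesis
    proof (cases rule: converse_rtranclpE)
      case (step z)
      then obtain xs a b ys where e: "?w = xs @ a # b # ys" "con a b (set xs)" unfolding step_def by blast
      then show ?thesis using adj[OF e(1)] contracts_Suc by blast
    qed
  qed
  have "card (Q_neighbors n R X) + des v = n - 1 + des v"
    using card_neighbours[OF X(1) v u] unfolding eu[symmetric] ev[symmetric] .
  then show ?thesis using X(1) by auto
qed

text \<open>Supplies the hypotheses of \<open>con_adjacent\<close>. The outer blocks and the order
  of \<open>a\<close>, \<open>b\<close> in \<open>m\<close> are left open so that it covers the full
  word as well as the stripped words \<open>x\<close> and \<open>z\<close>.\<close>

lemma fence_blocks:
  fixes a b :: nat
  assumes d: "distinct (A @ l @ m @ r @ G)" and s: "sorted l" "sorted r" and ab: "a < b"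
    and A: "\<forall>x\<in>set A. x < a" and G: "\<forall>x\<in>set G. b < x" and m: "set m = {a, b}"
    and l: "set l = L" "L \<subseteq> {a<..<b}" and r: "set r = {a<..<b} - L"
  shows "x \<in> L \<Longrightarrow> bef (A @ l @ m @ r @ G) y x \<Longrightarrow> y < x"
    "x \<in> {a<..<b} - L \<Longrightarrow> bef (A @ l @ m @ r @ G) x y \<Longrightarrow> x < y"
    "{a..b} \<subseteq> set (A @ l @ m @ r @ G)"
proof -
  have bl: "bef l y x \<Longrightarrow> y < x" and br: "bef r y x \<Longrightarrow> y < x" for x y
    using bef_sorted[of l y x] bef_sorted[of r y x] s d by auto
  {
    assume x: "x \<in> L" and b: "bef (A @ l @ m @ r @ G) y x"
    then have "x \<in> set l" "a < x" using l by auto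
    then have "x \<notin> set A" "x \<notin> set m" "x \<notin> set r" "x \<notin> set G" using d by auto
    then have "y \<in> set A \<or> bef l y x" using b bef_in_set by fastforce
    then show "y < x" using bl A \<open>a < x\<close> by fastforce
  }
  {
    assume x: "x \<in> {a<..<b} - L" and b: "bef (A @ l @ m @ r @ G) x y"
    then have "x \<in> set r" "x < b" using r by auto
    then have "x \<notin> set A" "x \<notin> set m" "x \<notin> set l" "x \<notin> set G" using d by auto
    then have "y \<in> set G \<or> bef r x y" using b bef_in_set by fastforce
    then show "x < y" using br G \<open>x < b\<close> by fastforce
  }
  have "{a..b} = {a<..<b} \<union> {a, b}" using ab by auto
  also have "\<dots> \<subseteq> set l \<union> set m \<union> set r" using l r m by blast
  finally show "{a..b} \<subseteq> set (A @ l @ m @ r @ G)" by auto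
qed

text \<open>The maximum \<open>v\<close> of the class of \<open>w\<close> is not known explicitly,
  as contracted edges may involve values outside \<open>[a, b]\<close>. Stripping these values keeps
  the number of descents of the maximum and leaves the word \<open>x\<close> on
  \<open>[a, b]\<close>, from which the swap of \<open>a, b\<close> is the only possible
  step.\<close>

lemma regular_imp_simple:
  assumes reg: "Q_regular n R" and f: "f \<in> reduced_arc_diagram n R"
  shows "simple_fence f"
proof (rule ccontr)
  assume ns: "\<not> simple_fence f"
  obtain a b L where [simp]: "f = (a, b, L)" by (cases f)
  have fC: "(a, b, L) \<in> contracted_fences n R" using f by (simp add: reduced_arc_diagram_def)
  then have fence: "is_fence n (a, b, L)" by (simp add: contracted_fences_def)
  then have ab: "1 \<le> a" "a < b" "b \<le> n" and L: "L \<subseteq> {a<..<b}" by (auto simp: is_fence_def)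
  have "b \<noteq> Suc a"
  proof
    assume "b = Suc a"
    moreover have "{a<..<Suc a} = {}" by auto
    ultimately have "(a, Suc a, {}) \<in> contracted_fences n R" using fC L by simp
    then show False using ess by (simp add: essential_def)
  qed
  then have nonsimple: "L \<noteq> {}" "{a<..<b} - L \<noteq> {}" using ns ab L by (auto simp: simple_fence_def)
  have maximal: "p = a \<and> q = b" if c: "con p q L" and pq: "a \<le> p" "q \<le> b" for p q
  proof -
    obtain c d where cd: "p \<le> c" "d \<le> q" "(c, d, L \<inter> {c<..<d}) \<in> contracted_fences n R"
      using c by (auto simp: contracts_def)
    have "c < d" using cd(3) by (auto simp: contracted_fences_def is_fence_def)
    have "\<not> forces_lt (a, b, L) (c, d, L \<inter> {c<..<d})"
      using f cd(3) unfolding reduced_arc_diagram_def by auto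
    then have "a = c" "b = d" using \<open>c < d\<close> cd pq by (auto simp: forces_lt_def)
    then show ?thesis using cd pq by auto
  qed
  define l where "l = sorted_list_of_set L"
  define r where "r = sorted_list_of_set ({a<..<b} - L)"
  have fin: "finite L" "finite ({a<..<b} - L)" using L finite_subset by auto
  have l: "set l = L" "sorted l" "distinct l" and r: "set r = {a<..<b} - L" "sorted r" "distinct r"
    unfolding l_def r_def using fin by auto
  define A where "A = [1..<a]"
  define G where "G = [Suc b..<Suc n]"
  define w where "w = A @ l @ [a, b] @ r @ G"
  have w_fence: "w = fence_word n a b L [a, b]"
    unfolding w_def A_def G_def l_def r_def fence_word_def by simp
  have AG: "\<forall>x\<in>set A. x < a" "\<forall>x\<in>set G. b < x" unfolding A_def G_def by (auto simp del: upt_Suc)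
  have wp: "w \<in> perms n" unfolding w_fence using fence_word_perms[OF fence] .
  then have dw: "distinct w" by (simp add: perms_def)
  \<comment> \<open>By maximality of the fence, the only contracted adjacent pair with values in
    \<open>[a, b]\<close> consists of \<open>a\<close> and \<open>b\<close>. The full word gives
    minimality of \<open>w\<close>, the empty outer blocks give the steps from \<open>x\<close> and
    \<open>z\<close>.\<close>
  have adj: "p = a \<and> q = b \<or> p = b \<and> q = a"
    if "A' @ l @ m @ r @ G' = xs @ p # q # ys" "distinct (A' @ l @ m @ r @ G')" "set m = {a, b}"
      "\<forall>x\<in>set A'. x < a" "\<forall>x\<in>set G'. b < x" "p \<in> {a..b}" "q \<in> {a..b}"
      "con (min p q) (max p q) (set xs)" for A' G' m xs p q ys
  proof -
    note B = fence_blocks[OF that(2) l(2) r(2) ab(2) that(4,5,3) l(1) L r(1)]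
    have "con (min p q) (max p q) L"
      using con_adjacent[OF that(2) B(3) B(1) B(2) that(1)] that(6,7,8) by auto
    then have "min p q = a \<and> max p q = b" using maximal that(6,7) by auto
    then show ?thesis by (auto simp: min_def max_def split: if_splits)
  qed
  have cmin: "cmin w" unfolding cmin_def
  proof (intro allI impI notI)
    fix xs p q ys assume e: "w = xs @ q # p # ys" and c: "con p q (set xs)"
    have pq: "p < q" using c by (rule contracts_less)
    have "(p, q) \<in> inversions w" using e pq by (auto simp: inversions_iff)
    then have i: "p \<noteq> a \<and> q \<in> L \<and> p \<in> {a<..<b} - L \<or> p = a \<and> q \<in> L \<or> q = b \<and> p \<in> {a<..<b} - L"
      using inversions_fence_word[OF fence] w_fence by blast
    then have "p \<in> {a..b}" "q \<in> {a..b}" using L ab by auto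
    then have "q = a \<and> p = b \<or> q = b \<and> p = a"
      using adj[of A "[a, b]" G xs q p ys] e dw AG c pq unfolding w_def by (simp add: min_def max_def)
    then show False using i L ab by auto
  qed
  obtain k where k: "Q_regular_of_degree n R k" using reg by (auto simp: Q_regular_def)
  then have kn: "k = n - 1" using card_neighbours_ident by (auto simp: Q_regular_of_degree_def)
  define X where "X = R `` {w}"
  have X: "X \<in> perms n // R" "w \<in> X"
    unfolding X_def using wp W.R_refl by (auto intro: quotientI)
  obtain v where v: "W.greatest_in X v" using W.greatest_exists[OF X(1)] by blast
  obtain u where u: "D.greatest_in X u" using D.greatest_exists[OF X(1)] by blast
  have "u = w" using cmin_least[OF X(1) u X(2) cmin] by simp
  then have des_eq: "des v = des w"
    using card_neighbours[OF X(1) v u] k X(1) kn by (simp add: Q_regular_of_degree_def)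
  have st: "step\<^sup>*\<^sup>* w v" using steps_in_class[OF X] v X(2) by (auto simp: W.greatest_in_def)
  define x where "x = l @ [a, b] @ r"
  define z where "z = l @ [b, a] @ r"
  have dx: "distinct x" "distinct z" "set x = set z" using dw unfolding w_def x_def z_def by auto
  have sx: "set x = {a..b}" unfolding x_def using l(1) r(1) L ab by auto
  \<comment> \<open>Exposes the numbers of values to strip, \<open>n - b\<close> at the end and
    \<open>a - 1\<close> in front, in the form of \<open>strip_max\<close> and
    \<open>strip_min\<close>.\<close>
  have G: "G = [Suc b..<Suc b + (n - b)]" and A: "A = [a - (a - 1)..<a]"
    unfolding G_def A_def using ab by simp_all
  have wx: "w = A @ x @ G" unfolding w_def x_def by simp
  have "\<exists>v'. step\<^sup>*\<^sup>* (A @ x) v' \<and> cmax v' \<and> des v' = des v"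
  proof (rule strip_max)
    show "\<forall>y\<in>set (A @ x). y \<le> b" using AG(1) sx ab by fastforce
    show "b \<in> set (A @ x)" using sx ab by simp
    show "distinct (A @ x)" using dw unfolding wx by auto
    show "step\<^sup>*\<^sup>* ((A @ x) @ [Suc b..<Suc b + (n - b)]) v" using st unfolding wx G by simp
    show "cmax v" using greatest_cmax[OF X(1) v] .
  qed
  then obtain v1 where v1: "step\<^sup>*\<^sup>* (A @ x) v1" "cmax v1" "des v1 = des v" by blast
  have "\<exists>v'. step\<^sup>*\<^sup>* x v' \<and> cmax v' \<and> des v' = des v1"
  proof (rule strip_min)
    show "\<forall>y\<in>set x. a \<le> y" "a \<in> set x" using sx ab by auto
    show "step\<^sup>*\<^sup>* ([a - (a - 1)..<a] @ x) v1" using v1(1) A by simp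
  qed (use dx v1 in auto)
  then obtain v2 where v2: "step\<^sup>*\<^sup>* x v2" "cmax v2" "des v2 = des v1" by blast
  have stepD: "p = a \<and> q = b" if "l @ m @ r = xs @ p # q # ys" "m = [a, b] \<or> m = [b, a]" "con p q (set xs)"
    for m xs p q ys
  proof -
    have pq: "p < q" using that(3) by (rule contracts_less)
    have "l @ m @ r = x \<or> l @ m @ r = z" using that(2) unfolding x_def z_def by blast
    then have d: "distinct (l @ m @ r)" and s: "set (l @ m @ r) = {a..b}"
      using dx sx by metis+
    have "p \<in> set (l @ m @ r)" "q \<in> set (l @ m @ r)" unfolding that(1) by simp_all
    then have p: "p \<in> {a..b}" "q \<in> {a..b}" unfolding s .
    have m: "set m = {a, b}" using that(2) by auto
    have mm: "min p q = p" "max p q = q" using pq by simp_all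
    have "p = a \<and> q = b \<or> p = b \<and> q = a"
      using adj[of "[]" m "[]" xs p q ys] that(1,3) d m p unfolding mm by simp
    then show ?thesis using pq ab by linarith
  qed
  have step_x: "y = z" if "step x y" for y
  proof -
    obtain xs p q ys where e: "x = xs @ p # q # ys" "y = xs @ q # p # ys" "con p q (set xs)"
      using \<open>step x y\<close> unfolding step_def by blast
    then have pq: "p = a" "q = b" using stepD[of "[a, b]" xs p q ys] unfolding x_def by auto
    then have "l @ a # b # r = xs @ a # b # ys" using e(1) unfolding x_def by simp
    moreover have "a \<notin> set l" "a \<notin> set (b # r)" using l(1) r(1) L ab by auto
    ultimately have "l = xs \<and> b # r = b # ys"
      using append_Cons_eq_iff[of a l "b # r" xs "b # ys"] by blast
    then show ?thesis using e(2) pq unfolding z_def by simp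
  qed
  have step_z: "\<not> step z y" for y
  proof
    assume "step z y"
    then obtain xs p q ys where e: "z = xs @ p # q # ys" "con p q (set xs)" unfolding step_def by blast
    then have pq: "p = a" "q = b" using stepD[of "[b, a]" xs p q ys] unfolding z_def by auto
    then have "bef z a b" using e(1) by simp
    moreover have "bef z b a" unfolding z_def by simp
    ultimately show False using bef_asym[OF dx(2), of a b] by simp
  qed
  have "v2 = x \<or> v2 = z"
    using v2(1)
  proof (induction rule: rtranclp_induct)
    case (step y y')
    then show ?case using step_x step_z by blast
  qed simp
  moreover have "v2 \<noteq> x"
  proof
    assume "v2 = x"
    then have "\<not> con a b L" using cmaxD[of l a b r] v2(2) l(1) unfolding x_def by simp
    moreover have "L \<inter> {a<..<b} = L" using L by auto
    ultimately show False using fC unfolding contracts_def by (metis order_refl)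
  qed
  ultimately have v2z: "v2 = z" by blast
  obtain l' p where lp: "l = l' @ [p]" using nonsimple l(1) by (cases l rule: rev_cases) auto
  obtain y r' where ry: "r = y # r'" using nonsimple r(1) by (cases r) auto
  have "p \<in> set l" "y \<in> set r" unfolding lp ry by simp_all
  then have pl: "a < p" "p < b" and py: "a < y" "y < b" using l(1) r(1) L by auto
  have "des z = 1"
    using des_sorted_blocks(2)[of l' p y r' a b] l(2) r(2) pl py unfolding z_def lp ry by simp
  moreover have "des w = 2"
  proof -
    have "\<forall>x\<in>set l. a < x" "\<forall>x\<in>set r. x < b" using l(1) r(1) L by auto
    then have "sorted (A @ l)" "sorted (r @ G)"
      using l(2) r(2) AG unfolding sorted_append A_def G_def
      by (fastforce simp del: upt_Suc intro: sorted_upt)+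
    then have "sorted ((A @ l') @ [p])" "sorted (y # r' @ G)" unfolding lp ry by simp_all
    then show ?thesis
      using des_sorted_blocks(1)[of "A @ l'" p y "r' @ G" a b] pl py unfolding w_def lp ry by simp
  qed
  ultimately show False using des_eq v1(3) v2(3) v2z by simp
qed

end

end

theorem mainTheorem13:
  fixes n :: nat and R :: "(nat list \<times> nat list) set"
  assumes "n \<ge> 1"
    and "lattice_congruence n R"
    and "essential n R"
  shows "(Q_regular n R \<longleftrightarrow> (\<forall>f \<in> reduced_arc_diagram n R. simple_fence f))
     \<and> ((\<forall>f \<in> reduced_arc_diagram n R. simple_fence f) \<longrightarrow> Q_regular_of_degree n R (n - 1))"
  using simple_regular[OF assms(2,3)] regular_imp_simple[OF assms(2,3)] unfolding Q_regular_def by blast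

end
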